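(* Fix a difference equation $\hat{\boldsymbol\omega}=(1/\hat f,\hat q,\hat w)\in\Omega_N^{\mathbb{R},+}$. Then for each $\mathbf{A}\in\mathcal{B}_{2,4}$, $(\hat{\boldsymbol\omega},\mathbf{A})$ has exactly $N-1$ eigenvalues, and for each $\mathbf{A}\in\mathcal{O}_{2,4}^{\mathbb{C}}\setminus\mathcal{B}_{2,4}$, $(\hat{\boldsymbol\omega},\mathbf{A})$ has exactly $N$ eigenvalues $\lambda_n(\mathbf{A}):=\lambda_n(\hat{\boldsymbol\omega},\mathbf{A})$, $0\le n\le N-1$, which satisfy that: (i) the $\lambda_n(\mathbf{A})$ are continuous in $\mathcal{O}_{2,4}^{\mathbb{C}}\setminus\mathcal{B}_{2,4}$; (ii) the $\lambda_n(\mathbf{A})$ restricted in $\mathcal{B}_{2,4}^+$ and $\mathcal{B}_{2,4}^-$ are always non-decreasing in the $a_{11}$-direction and in the $b_{21}$-direction; (iii) the $\lambda_n(\mathbf{A})$, $0\le n\le N-1$, are not continuous at each point of $\mathcal{B}_{2,4}$ and have the following asymptotic behaviors near any given $\mathbf{A}_0\in\mathcal{B}_{2,4}$: $$\lim_{\mathcal{B}_{2,4}^-\cup\mathcal{B}_{2,4}\ni\mathbf{A}\to\mathbf{A}_0}\lambda_n(\mathbf{A})=\lambda_n(\mathbf{A}_0),\ 0\le n\le N-2,\qquad \lim_{\mathcal{B}_{2,4}^-\ni\mathbf{A}\to\mathbf{A}_0}\lambda_{N-1}(\mathbf{A})=+\infty,$$ $$\lim_{\mathcal{B}_{2,4}^+\ni\mathbf{A}\to\mathbf{A}_0}\lambda_0(\mathbf{A})=-\infty,\qquad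 \lim_{\mathcal{B}_{2,4}^+\ni\mathbf{A}\to\mathbf{A}_0}\lambda_n(\mathbf{A})=\lambda_{n-1}(\mathbf{A}_0),\ 1\le n\le N-1.$$ Consequently, $\lambda_n(\mathbf{A})$ restricted in $\mathcal{B}_{2,4}^-\cup\mathcal{B}_{2,4}$ is continuous for each $0\le n\le N-2$.
   Context: Fix an integer $N\ge 2$. A self-adjoint discrete Sturm–Liouville problem is a pair $(\boldsymbol\omega,\mathbf{A})$. Here $\boldsymbol\omega=(1/f,q,w)$ with real sequences $f=\{f_n\}_{n=0}^N$, $q=\{q_n\}_{n=1}^N$, $w=\{w_n\}_{n=1}^N$, $f_n\ne0$, $w_n>0$, encodes the equation $-\nabla(f_n\Delta y_n)+q_ny_n=\lambda w_ny_n$, $1\le n\le N$, for $y=(y_0,\dots,y_{N+1})$, with $\Delta y_n=y_{n+1}-y_n$, $\nabla y_n=y_n-y_{n-1}$; $\Omega_N^{\mathbb{R},+}\subset\mathbb{R}^{3N+1}$ is the set of all such $(1/f,q,w)$. $\mathbf{A}=[A\,|\,B]$ encodes the boundary condition $A\begin{pmatrix}y_0\\ f_0\Delta y_0\end{pmatrix}+B\begin{pmatrix}y_N\\ f_N\Delta y_N\end{pmatrix}=0$, where $A,B$ are complex $2\times2$ matrices with $\mathrm{rank}(A,B)=2$ and $AJA^*=BJB^*$, $J=\begin{pmatrix}0&1\\-1&0\end{pmatrix}$; $[A\,|\,B]$ is the class of the $2\times4$ matrix $(A,B)$ modulo left multiplication by $GL(2,\mathbb{C})$, and $\mathcal{B}^{\mathbb{C}}$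 is the set of all such classes, topologized as a subspace of the quotient of the rank-2 complex $2\times4$ matrices by $GL(2,\mathbb{C})$. An eigenvalue of $(\boldsymbol\omega,\mathbf{A})$ is a $\lambda$ for which a nonzero $y$ solves the equation and the boundary condition. Eigenvalues are real and finite in number; they are counted with multiplicity (the dimension of the solution space) and listed as $\lambda_0\le\lambda_1\le\cdots$; $\lambda_n$ is defined at a problem only if it has more than $n$ eigenvalues, and $\lambda_n$ is regarded as not continuous at a point where it is not defined. $\mathcal{O}_{2,4}^{\mathbb{C}}=\left\{\left[\begin{array}{cccc}a_{11}&-1&\bar z&0\\ z&0&b_{21}&1\end{array}\right]:a_{11},b_{21}\in\mathbb{R},\ z\in\mathbb{C}\right\}$, an open subset of $\mathcal{B}^{\mathbb{C}}$ with coordinates $(a_{11},\mathrm{Re}\,z,\mathrm{Im}\,z,b_{21})$ identifying it with $\mathbb{R}^4$. For the fixed $\hat{\boldsymbol\omega}$, $\mathcal{B}_{2,4}$, $\mathcal{B}_{2,4}^+$, $\mathcal{B}_{2,4}^-$ are the sets of $\mathbf{A}\in\mathcal{O}_{2,4}^{\mathbb{C}}$ with $a_{11}=-\hat f_0$, $a_{11}>-\hat f_0$, $a_{11}<-\hat f_0$, respectively. Monotone in a coordinate direction means with the other coordinates fixed.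
   Formalization: In (iii), discontinuity of λ_n at A_0 in B_{2,4} is not claimed when 1≤n≤N-2 and λ_{n-1}(A_0)=λ_n(A_0); there the stated limits make λ_n continuous (e.g. N=3, f=w=1, q=0, a_11=z=-1, b_21=1, n=1). *)

theory Defs
  imports "HOL-Analysis.Analysis" "HOL-Library.Function_Algebras"
begin

section \<open>The space of self-adjoint boundary conditions\<close>

text \<open>A \<open>2 \<times> 4\<close> complex matrix \<open>M\<close> stands for the pair \<open>(A, B)\<close> of its left and right
  \<open>2 \<times> 2\<close> blocks.\<close>

definition left_block :: "complex^4^2 \<Rightarrow> complex^2^2" where
  "left_block M = vector [vector [M $ 1 $ 1, M $ 1 $ 2], vector [M $ 2 $ 1, M $ 2 $ 2]]"

definition right_block :: "complex^4^2 \<Rightarrow> complex^2^2" where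
  "right_block M = vector [vector [M $ 1 $ 3, M $ 1 $ 4], vector [M $ 2 $ 3, M $ 2 $ 4]]"

definition conj_transpose :: "complex^'n^'m \<Rightarrow> complex^'m^'n" where
  "conj_transpose A = (\<chi> i j. cnj (A $ j $ i))"

definition symp_J :: "complex^2^2" where
  "symp_J = vector [vector [0, 1], vector [-1, 0]]"

definition rank2_matrices :: "(complex^4^2) set" where
  "rank2_matrices = {M. rank M = 2}"

definition self_adjoint_matrix :: "complex^4^2 \<Rightarrow> bool" where
  "self_adjoint_matrix M \<longleftrightarrow>
     left_block M ** symp_J ** conj_transpose (left_block M) =
     right_block M ** symp_J ** conj_transpose (right_block M)"

definition bc_class :: "complex^4^2 \<Rightarrow> (complex^4^2) set" where
  "bc_class M = {P ** M | P :: complex^2^2. invertible P}"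

definition rank2_classes :: "(complex^4^2) set topology" where
  "rank2_classes = topology (\<lambda>U. U \<subseteq> bc_class ` rank2_matrices \<and>
     openin (top_of_set rank2_matrices) {M \<in> rank2_matrices. bc_class M \<in> U})"

definition self_adjoint_bcs :: "(complex^4^2) set set" where
  "self_adjoint_bcs = bc_class ` {M \<in> rank2_matrices. self_adjoint_matrix M}"

definition bc_space :: "(complex^4^2) set topology" where
  "bc_space = subtopology rank2_classes self_adjoint_bcs"

lemma openin_rank2_classes:
  "openin rank2_classes U \<longleftrightarrow> U \<subseteq> bc_class ` rank2_matrices \<and>
     openin (top_of_set rank2_matrices) {M \<in> rank2_matrices. bc_class M \<in> U}"
proof -
  let ?C = "bc_class ` rank2_matrices"
  let ?pre = "\<lambda>U. {M \<in> rank2_matrices. bc_class M \<in> U}"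
  have "istopology (\<lambda>U. U \<subseteq> ?C \<and> openin (top_of_set rank2_matrices) (?pre U))"
    unfolding istopology_def
  proof (intro conjI allI impI; (elim conjE)?)
    fix S T assume "openin (top_of_set rank2_matrices) (?pre S)"
      and "openin (top_of_set rank2_matrices) (?pre T)"
    moreover have "?pre (S \<inter> T) = ?pre S \<inter> ?pre T" by auto
    ultimately show "openin (top_of_set rank2_matrices) (?pre (S \<inter> T))"
      by (simp add: openin_Int)
  next
    fix K assume K: "\<forall>S\<in>K. S \<subseteq> ?C \<and> openin (top_of_set rank2_matrices) (?pre S)"
    have "?pre (\<Union>K) = \<Union>(?pre ` K)" by auto
    moreover have "openin (top_of_set rank2_matrices) (\<Union>(?pre ` K))"
      using K by (intro openin_Union) auto
    ultimately show "openin (top_of_set rank2_matrices) (?pre (\<Union>K))" by (rule ssubst)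
  qed blast+
  then show ?thesis
    by (simp add: rank2_classes_def)
qed

lemma topspace_rank2_classes: "topspace rank2_classes = bc_class ` rank2_matrices"
proof -
  have "{M \<in> rank2_matrices. bc_class M \<in> bc_class ` rank2_matrices} = rank2_matrices"
    by auto
  then have "openin rank2_classes (bc_class ` rank2_matrices)"
    by (simp add: openin_rank2_classes)
  then have "bc_class ` rank2_matrices \<subseteq> topspace rank2_classes"
    by (rule openin_subset)
  moreover have "topspace rank2_classes \<subseteq> bc_class ` rank2_matrices"
    using openin_topspace[of rank2_classes] unfolding openin_rank2_classes by (rule conjunct1)
  ultimately show ?thesis by (rule subset_antisym[rotated])
qed

lemma quotient_map_bc_class:
  "quotient_map (top_of_set rank2_matrices) rank2_classes bc_class"
  unfolding quotient_map_def by (auto simp: topspace_rank2_classes openin_rank2_classes)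

lemma topspace_bc_space: "topspace bc_space = self_adjoint_bcs"
  by (auto simp: bc_space_def topspace_rank2_classes self_adjoint_bcs_def)


section \<open>Eigenvalues\<close>

definition fwd_diff :: "(nat \<Rightarrow> complex) \<Rightarrow> nat \<Rightarrow> complex" where
  "fwd_diff y n = y (n + 1) - y n"

definition bwd_diff :: "(nat \<Rightarrow> complex) \<Rightarrow> nat \<Rightarrow> complex" where
  "bwd_diff y n = y n - y (n - 1)"

definition satisfies_equation ::
  "nat \<Rightarrow> (nat \<Rightarrow> real) \<Rightarrow> (nat \<Rightarrow> real) \<Rightarrow> (nat \<Rightarrow> real) \<Rightarrow> complex \<Rightarrow> (nat \<Rightarrow> complex) \<Rightarrow> bool" where
  "satisfies_equation N f q w l y \<longleftrightarrow> (\<forall>n\<in>{1..N}.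
     - bwd_diff (\<lambda>k. of_real (f k) * fwd_diff y k) n + of_real (q n) * y n
       = l * of_real (w n) * y n)"

text \<open>Left multiplication by an invertible matrix does not change the solution set of the
  boundary condition, so quantifying over all representatives agrees with choosing one.\<close>

definition satisfies_bc ::
  "nat \<Rightarrow> (nat \<Rightarrow> real) \<Rightarrow> (complex^4^2) set \<Rightarrow> (nat \<Rightarrow> complex) \<Rightarrow> bool" where
  "satisfies_bc N f A y \<longleftrightarrow> (\<forall>M\<in>A.
     left_block M *v vector [y 0, of_real (f 0) * fwd_diff y 0] +
     right_block M *v vector [y N, of_real (f N) * fwd_diff y N] = 0)"

text \<open>A vector \<open>(y\<^sub>0, \<dots>, y\<^bsub>N+1\<^esub>)\<close> is a function on \<open>nat\<close> vanishing beyond \<open>N + 1\<close>.\<close>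

definition eigenspace ::
  "nat \<Rightarrow> (nat \<Rightarrow> real) \<Rightarrow> (nat \<Rightarrow> real) \<Rightarrow> (nat \<Rightarrow> real) \<Rightarrow> (complex^4^2) set \<Rightarrow> complex
     \<Rightarrow> (nat \<Rightarrow> complex) set" where
  "eigenspace N f q w A l = {y. (\<forall>n>N + 1. y n = 0) \<and>
     satisfies_equation N f q w l y \<and> satisfies_bc N f A y}"

definition spectrum ::
  "nat \<Rightarrow> (nat \<Rightarrow> real) \<Rightarrow> (nat \<Rightarrow> real) \<Rightarrow> (nat \<Rightarrow> real) \<Rightarrow> (complex^4^2) set \<Rightarrow> complex set" where
  "spectrum N f q w A = {l. \<exists>y\<in>eigenspace N f q w A l. y \<noteq> 0}"

definition scale_seq :: "complex \<Rightarrow> (nat \<Rightarrow> complex) \<Rightarrow> nat \<Rightarrow> complex" where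
  "scale_seq c y = (\<lambda>n. c * y n)"

lemma vector_space_scale_seq: "vector_space scale_seq"
  by unfold_locales (auto simp: scale_seq_def fun_eq_iff algebra_simps)

definition eig_mult ::
  "nat \<Rightarrow> (nat \<Rightarrow> real) \<Rightarrow> (nat \<Rightarrow> real) \<Rightarrow> (nat \<Rightarrow> real) \<Rightarrow> (complex^4^2) set \<Rightarrow> complex \<Rightarrow> nat" where
  "eig_mult N f q w A l = vector_space.dim scale_seq (eigenspace N f q w A l)"

definition has_exactly_eigenvalues ::
  "nat \<Rightarrow> (nat \<Rightarrow> real) \<Rightarrow> (nat \<Rightarrow> real) \<Rightarrow> (nat \<Rightarrow> real) \<Rightarrow> (complex^4^2) set \<Rightarrow> nat \<Rightarrow> bool" where
  "has_exactly_eigenvalues N f q w A k \<longleftrightarrow>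
     finite (spectrum N f q w A) \<and> spectrum N f q w A \<subseteq> \<real> \<and>
     (\<Sum>l\<in>spectrum N f q w A. eig_mult N f q w A l) = k"

definition eigenvalue_list ::
  "nat \<Rightarrow> (nat \<Rightarrow> real) \<Rightarrow> (nat \<Rightarrow> real) \<Rightarrow> (nat \<Rightarrow> real) \<Rightarrow> (complex^4^2) set \<Rightarrow> real list" where
  "eigenvalue_list N f q w A =
     concat (map (\<lambda>x. replicate (eig_mult N f q w A (of_real x)) x)
       (sorted_list_of_set {x. of_real x \<in> spectrum N f q w A}))"

text \<open>The \<open>n\<close>-th eigenvalue is meaningful only where \<open>nth_eigenvalue_defined\<close> holds;
  elsewhere its value is arbitrary.\<close>

definition nth_eigenvalue ::
  "nat \<Rightarrow> (nat \<Rightarrow> real) \<Rightarrow> (nat \<Rightarrow> real) \<Rightarrow> (nat \<Rightarrow> real) \<Rightarrow> nat \<Rightarrow> (complex^4^2) set \<Rightarrow> real" where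
  "nth_eigenvalue N f q w n A = eigenvalue_list N f q w A ! n"

definition nth_eigenvalue_defined ::
  "nat \<Rightarrow> (nat \<Rightarrow> real) \<Rightarrow> (nat \<Rightarrow> real) \<Rightarrow> (nat \<Rightarrow> real) \<Rightarrow> nat \<Rightarrow> (complex^4^2) set \<Rightarrow> bool" where
  "nth_eigenvalue_defined N f q w n A \<longleftrightarrow> n < length (eigenvalue_list N f q w A)"

text \<open>Continuity at a point of the partial function \<open>\<lambda>\<^sub>n\<close> on the space of boundary conditions:
  by convention it fails where \<open>\<lambda>\<^sub>n\<close> is undefined.\<close>

definition nth_eigenvalue_continuous_at ::
  "nat \<Rightarrow> (nat \<Rightarrow> real) \<Rightarrow> (nat \<Rightarrow> real) \<Rightarrow> (nat \<Rightarrow> real) \<Rightarrow> nat \<Rightarrow> (complex^4^2) set \<Rightarrow> bool" where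
  "nth_eigenvalue_continuous_at N f q w n A0 \<longleftrightarrow>
     nth_eigenvalue_defined N f q w n A0 \<and>
     (nth_eigenvalue N f q w n \<longlongrightarrow> nth_eigenvalue N f q w n A0)
       (atin_within bc_space A0 {A. nth_eigenvalue_defined N f q w n A})"


section \<open>The coordinate chart and its layers\<close>

definition bc24_matrix :: "real \<Rightarrow> complex \<Rightarrow> real \<Rightarrow> complex^4^2" where
  "bc24_matrix a z b =
     vector [vector [of_real a, -1, cnj z, 0],
             vector [z, 0, of_real b, 1]]"

definition bc24 :: "real \<Rightarrow> complex \<Rightarrow> real \<Rightarrow> (complex^4^2) set" where
  "bc24 a z b = bc_class (bc24_matrix a z b)"

definition O24 :: "(complex^4^2) set set" where
  "O24 = {bc24 a z b | a z b. True}"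

text \<open>The parameter of the layers is the leading coefficient \<open>f 0\<close>.\<close>

definition B24 :: "real \<Rightarrow> (complex^4^2) set set" where
  "B24 f0 = {bc24 a z b | a z b. a = - f0}"

definition B24_plus :: "real \<Rightarrow> (complex^4^2) set set" where
  "B24_plus f0 = {bc24 a z b | a z b. a > - f0}"

definition B24_minus :: "real \<Rightarrow> (complex^4^2) set set" where
  "B24_minus f0 = {bc24 a z b | a z b. a < - f0}"

lemma vector_4 [simp]:
  "(vector [x, y, z, u] :: 'a::zero^4) $ 1 = x"
  "(vector [x, y, z, u] :: 'a::zero^4) $ 2 = y"
  "(vector [x, y, z, u] :: 'a::zero^4) $ 3 = z"
  "(vector [x, y, z, u] :: 'a::zero^4) $ 4 = u"
  unfolding vector_def by simp_all

lemma bc24_matrix_rank2: "bc24_matrix a z b \<in> rank2_matrices"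
proof -
  let ?r1 = "vector [of_real a, -1, cnj z, 0] :: complex^4"
  let ?r2 = "vector [z, 0, of_real b, 1] :: complex^4"
  have "rows M = {M $ 1, M $ 2}" for M :: "complex^4^2"
    unfolding rows_def row_def vec_lambda_eta setcompr_eq_image by (auto simp: UNIV_2)
  then have rows: "rows (bc24_matrix a z b) = {?r1, ?r2}"
    by (simp add: bc24_matrix_def)
  have ne: "?r1 \<noteq> ?r2" by (auto simp: vec_eq_iff forall_4)
  have "?r1 \<notin> vec.span {?r2}"
    by (auto simp: vec.span_singleton vec_eq_iff forall_4)
  moreover have "?r2 \<noteq> 0" by (auto simp: vec_eq_iff forall_4)
  ultimately have "vec.independent {?r1, ?r2}"
    by (simp add: vec.independent_insert)
  then have "vec.dim {?r1, ?r2} = 2"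
    using ne by (simp add: vec.dim_eq_card_independent)
  then show ?thesis
    by (simp add: rank2_matrices_def row_rank_def_gen rows)
qed

lemma bc24_matrix_self_adjoint: "self_adjoint_matrix (bc24_matrix a z b)"
  by (simp add: self_adjoint_matrix_def left_block_def right_block_def symp_J_def
      conj_transpose_def bc24_matrix_def matrix_matrix_mult_def vec_eq_iff forall_2 sum_2)

lemma O24_subset: "O24 \<subseteq> self_adjoint_bcs"
  using bc24_matrix_rank2 bc24_matrix_self_adjoint
  by (auto simp: O24_def bc24_def self_adjoint_bcs_def)

end

theory Submission
  imports Defs
begin

text \<open>Keep \<open>y\<^sub>0\<close> as an unknown and eliminate only \<open>y\<^bsub>N+1\<^esub>\<close>.  The problem becomes a Hermitian pencil
  \<open>H - t W\<close> on \<open>\<complex>\<^bsup>N+1\<^esup>\<close>, where \<open>H\<close> depends continuously on \<open>(a, z, b)\<close>, also across the layer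
  \<open>a = - f 0\<close>, and \<open>W = diag (0, w\<^sub>1, \<dots>, w\<^sub>N)\<close> is degenerate.  Let \<open>\<nu>(t)\<close> be the number of negative
  squares of \<open>H - t W\<close>.  By Sylvester's law of inertia, \<open>\<nu>\<close> jumps at each eigenvalue exactly by its
  multiplicity, and for \<open>t \<rightarrow> -\<infinity>\<close> it equals \<open>1\<close> if \<open>a \<le> - f 0\<close> and \<open>0\<close> if \<open>a > - f 0\<close>.  Hence
  \<open>\<lambda>\<^sub>n < t\<close> means \<open>\<nu>(t) > n + 1\<close> if \<open>a \<le> - f 0\<close> and \<open>\<nu>(t) > n\<close> if \<open>a > - f 0\<close>.  Since \<open>\<nu>(t)\<close> is antitone in
  \<open>a\<close> and \<open>b\<close>, and locally constant in \<open>(a, z, b)\<close> when \<open>t\<close> is not an eigenvalue, monotonicity,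
  continuity and all the limits at the layer follow; the change of the shift from \<open>1\<close> to \<open>0\<close> is the
  jump of the index of the eigenvalues across the layer.\<close>

section \<open>Linear algebra of finitely supported sequences\<close>

global_interpretation seqs: vector_space scale_seq
  by (rule vector_space_scale_seq)

global_interpretation seqs: vector_space_pair scale_seq scale_seq ..

lemma sum_seq_apply: "(\<Sum>i\<in>I. g i) n = (\<Sum>i\<in>I. g i n)" for g :: "'i \<Rightarrow> nat \<Rightarrow> complex"
  by (induction I rule: infinite_finite_induct) auto

lemma scale_seq_apply: "scale_seq c x n = c * x n"
  by (simp add: scale_seq_def)

text \<open>Injectivity is asked for on the subspace alone, because the later map
  \<open>extend\<close> overwrites one coordinate and becomes injective only once that coordinate is
  fixed.\<close>

lemma dim_linear_image_inj_on:
  assumes f: "Vector_Spaces.linear scale_seq scale_seq f" and S: "seqs.subspace S" and "inj_on f S"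
  shows "seqs.dim (f ` S) = seqs.dim S"
proof -
  obtain B where B: "B \<subseteq> S" "seqs.independent B" "S \<subseteq> seqs.span B" "card B = seqs.dim S"
    using seqs.basis_exists by blast
  have "seqs.span B = S"
    using B S by (simp add: seqs.span_minimal subset_antisym)
  with assms(3) have inj: "inj_on f (seqs.span B)" by simp
  show ?thesis
  proof (rule seqs.dim_unique)
    show "f ` B \<subseteq> f ` S" using B by blast
    show "f ` S \<subseteq> seqs.span (f ` B)"
      using \<open>seqs.span B = S\<close> seqs.linear_span_image[OF f, of B] by simp
    show "seqs.independent (f ` B)"
      using f B(2) inj by (rule seqs.linear_independent_injective_image)
    show "card (f ` B) = seqs.dim S"
      using inj_on_subset[OF assms(3) B(1)] B(4) by (simp add: card_image)
  qed
qed

text \<open>A model of C^d inside the vector space in which eigenfunctions live, so that kernels of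
  matrices and eigenspaces share one notion of dimension.\<close>

definition coords :: "nat \<Rightarrow> (nat \<Rightarrow> complex) set" where
  "coords d = {x. \<forall>n\<ge>d. x n = 0}"

definition unit_seq :: "nat \<Rightarrow> nat \<Rightarrow> complex" where
  "unit_seq i = (\<lambda>n. if n = i then 1 else 0)"

lemma subspace_coords: "seqs.subspace (coords d)"
  by (auto simp: seqs.subspace_def coords_def scale_seq_apply)

lemma unit_seq_in_coords: "i < d \<Longrightarrow> unit_seq i \<in> coords d"
  by (auto simp: unit_seq_def coords_def)

lemma inj_unit_seq: "inj unit_seq"
  by (auto simp: inj_def unit_seq_def fun_eq_iff split: if_splits)

lemma sum_unit_seq_apply:
  "finite I \<Longrightarrow> (\<Sum>i\<in>I. scale_seq (c i) (unit_seq i)) n = (if n \<in> I then c n else 0)"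
  by (simp add: sum_seq_apply scale_seq_apply unit_seq_def if_distrib cong: if_cong)

lemma independent_unit_seqs:
  assumes "finite I"
  shows "seqs.independent (unit_seq ` I)"
proof (rule seqs.independent_if_scalars_zero)
  fix c x assume 0: "(\<Sum>x\<in>unit_seq ` I. scale_seq (c x) x) = 0" and "x \<in> unit_seq ` I"
  then obtain i where i: "i \<in> I" "x = unit_seq i" by blast
  have "(\<Sum>x\<in>unit_seq ` I. scale_seq (c x) x) = (\<Sum>i\<in>I. scale_seq (c (unit_seq i)) (unit_seq i))"
    using inj_unit_seq by (subst sum.reindex) (auto intro: inj_on_subset)
  then have "(\<Sum>i\<in>I. scale_seq (c (unit_seq i)) (unit_seq i)) i = 0"
    using 0 by simp
  then show "c x = 0"
    using i assms by (simp only: sum_unit_seq_apply if_True)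
qed (use assms in simp)

lemma coords_eq_span: "coords d = seqs.span (unit_seq ` {..<d})"
proof
  show "coords d \<subseteq> seqs.span (unit_seq ` {..<d})"
  proof
    fix x assume "x \<in> coords d"
    then have "x = (\<Sum>i<d. scale_seq (x i) (unit_seq i))"
      by (auto simp: fun_eq_iff sum_unit_seq_apply coords_def not_less)
    also have "\<dots> \<in> seqs.span (unit_seq ` {..<d})"
      by (intro seqs.span_sum seqs.span_scale seqs.span_base) auto
    finally show "x \<in> seqs.span (unit_seq ` {..<d})" .
  qed
  show "seqs.span (unit_seq ` {..<d}) \<subseteq> coords d"
    by (intro seqs.span_minimal subspace_coords) (auto simp: unit_seq_in_coords)
qed

lemma dim_span_unit_seqs: "finite I \<Longrightarrow> seqs.dim (seqs.span (unit_seq ` I)) = card I"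
  using inj_on_subset[OF inj_unit_seq, of I]
  by (simp add: seqs.dim_span_eq_card_independent independent_unit_seqs card_image del: seqs.dim_span)

lemma dim_coords: "seqs.dim (coords d) = d"
  by (simp add: coords_eq_span dim_span_unit_seqs del: seqs.dim_span)

section \<open>Finite bases and dimension count in coordinate subspaces\<close>

lemma independent_coords_bound:
  assumes "seqs.independent B" "B \<subseteq> coords d"
  shows "finite B \<and> card B \<le> d"
proof -
  have "finite B \<and> card B \<le> card (unit_seq ` {..<d})"
    using assms by (intro seqs.independent_span_bound) (auto simp: coords_eq_span)
  moreover have "card (unit_seq ` {..<d}) \<le> d"
    using card_image_le[of "{..<d}" unit_seq] by simp
  ultimately show ?thesis by simp
qed

lemma coords_basis:
  assumes "S \<subseteq> coords d"
  obtains B where "B \<subseteq> S" "seqs.independent B" "S \<subseteq> seqs.span B" "finite B"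
    "card B = seqs.dim S"
  using seqs.basis_exists independent_coords_bound assms by (metis subset_trans)

lemma dim_le_coords: "S \<subseteq> coords d \<Longrightarrow> seqs.dim S \<le> d"
  by (metis coords_basis independent_coords_bound subset_trans)

lemma dim_pos_iff:
  assumes "S \<subseteq> coords d"
  shows "0 < seqs.dim S \<longleftrightarrow> (\<exists>x\<in>S. x \<noteq> 0)"
proof -
  obtain B where B: "B \<subseteq> S" "seqs.independent B" "S \<subseteq> seqs.span B" "finite B" "card B = seqs.dim S"
    using coords_basis[OF assms] .
  show ?thesis
  proof (cases "B = {}")
    case True
    with B show ?thesis by auto
  next
    case False
    then obtain b where "b \<in> B" by blast
    moreover have "b \<noteq> 0" using B(2) \<open>b \<in> B\<close> seqs.dependent_zero by blast
    ultimately show ?thesis using B False by (metis card_gt_0_iff subsetD)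
  qed
qed

text \<open>The ambient \<open>coords d\<close> supplies finite bases. A linear relation on their
  union equates a vector of S with one of T, hence splits into a relation on each basis.\<close>

lemma dim_span_Un_direct:
  assumes S: "seqs.subspace S" "S \<subseteq> coords d" and T: "seqs.subspace T" "T \<subseteq> coords d"
    and ST: "S \<inter> T \<subseteq> {0}"
  shows "seqs.dim (seqs.span (S \<union> T)) = seqs.dim S + seqs.dim T"
proof -
  obtain B where B: "B \<subseteq> S" "seqs.independent B" "S \<subseteq> seqs.span B" "finite B" "card B = seqs.dim S"
    using coords_basis[OF S(2)] .
  obtain C where C: "C \<subseteq> T" "seqs.independent C" "T \<subseteq> seqs.span C" "finite C" "card C = seqs.dim T"
    using coords_basis[OF T(2)] .
  have disj: "B \<inter> C = {}"
    using B(1,2) C(1) ST seqs.dependent_zero by blast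
  have "seqs.independent (B \<union> C)"
  proof (rule seqs.independent_if_scalars_zero)
    fix c x assume 0: "(\<Sum>x\<in>B \<union> C. scale_seq (c x) x) = 0" and x: "x \<in> B \<union> C"
    let ?b = "\<Sum>x\<in>B. scale_seq (c x) x" and ?c = "\<Sum>x\<in>C. scale_seq (c x) x"
    have sum: "?b + ?c = 0"
      using 0 B(4) C(4) disj by (simp add: sum.union_disjoint)
    have "?b \<in> S" "?c \<in> T"
      using B(1) C(1) S(1) T(1) by (auto intro!: seqs.subspace_sum seqs.subspace_scale)
    moreover have "?b = - ?c"
      using sum by (simp add: eq_neg_iff_add_eq_0)
    ultimately have "?b \<in> S \<inter> T"
      using seqs.subspace_neg[OF T(1)] by simp
    then have "?b = 0" using ST by blast
    moreover from this have "?c = 0" using sum by simp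
    ultimately show "c x = 0"
      using x B(2,4) C(2,4) seqs.independentD[of B B c x] seqs.independentD[of C C c x] by auto
  qed (use B C in simp)
  moreover have "B \<union> C \<subseteq> seqs.span (S \<union> T)"
    using B(1) C(1) seqs.span_superset[of "S \<union> T"] by blast
  moreover have "seqs.span (S \<union> T) \<subseteq> seqs.span (B \<union> C)"
  proof (rule seqs.span_minimal)
    show "S \<union> T \<subseteq> seqs.span (B \<union> C)"
      using B(3) C(3) seqs.span_mono[of B "B \<union> C"] seqs.span_mono[of C "B \<union> C"] by blast
  qed simp
  moreover have "card (B \<union> C) = seqs.dim S + seqs.dim T"
    using B C disj by (simp add: card_Un_disjoint)
  ultimately show ?thesis by (metis seqs.dim_unique)
qed

lemma span_Un_subspaces:
  assumes "seqs.subspace S" "seqs.subspace T"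
  shows "seqs.span (S \<union> T) = {x + y | x y. x \<in> S \<and> y \<in> T}"
  using assms by (simp add: seqs.span_Un seqs.span_eq_iff[THEN iffD2])

section \<open>The inertia of a Hermitian form\<close>

definition mat_vec :: "nat \<Rightarrow> (nat \<Rightarrow> nat \<Rightarrow> complex) \<Rightarrow> (nat \<Rightarrow> complex) \<Rightarrow> nat \<Rightarrow> complex" where
  "mat_vec d M x i = (\<Sum>j<d. M i j * x j)"

definition kernel :: "nat \<Rightarrow> (nat \<Rightarrow> nat \<Rightarrow> complex) \<Rightarrow> (nat \<Rightarrow> complex) set" where
  "kernel d M = {x \<in> coords d. \<forall>i<d. mat_vec d M x i = 0}"

definition sesq :: "nat \<Rightarrow> (nat \<Rightarrow> nat \<Rightarrow> complex) \<Rightarrow> (nat \<Rightarrow> complex) \<Rightarrow> (nat \<Rightarrow> complex) \<Rightarrow> complex" where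
  "sesq d M x y = (\<Sum>i<d. cnj (x i) * mat_vec d M y i)"

abbreviation qform :: "nat \<Rightarrow> (nat \<Rightarrow> nat \<Rightarrow> complex) \<Rightarrow> (nat \<Rightarrow> complex) \<Rightarrow> real" where
  "qform d M x \<equiv> Re (sesq d M x x)"

definition hermitian :: "(nat \<Rightarrow> nat \<Rightarrow> complex) \<Rightarrow> bool" where
  "hermitian M \<longleftrightarrow> (\<forall>i j. M j i = cnj (M i j))"

definition neg_subspace :: "nat \<Rightarrow> (nat \<Rightarrow> nat \<Rightarrow> complex) \<Rightarrow> (nat \<Rightarrow> complex) set \<Rightarrow> bool" where
  "neg_subspace d M S \<longleftrightarrow>
     seqs.subspace S \<and> S \<subseteq> coords d \<and> (\<forall>x\<in>S. x \<noteq> 0 \<longrightarrow> qform d M x < 0)"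

text \<open>The negative index of inertia in variational form. The set of dimensions contains that
  of \<open>{0}\<close> and is bounded by d, so the maximum is attained; comparisons of forms can
  then act on witnessing subspaces.\<close>

definition neg_index :: "nat \<Rightarrow> (nat \<Rightarrow> nat \<Rightarrow> complex) \<Rightarrow> nat" where
  "neg_index d M = Max (seqs.dim ` {S. neg_subspace d M S})"

section \<open>Sesquilinearity and Hermitian symmetry\<close>

lemma mat_vec_add: "mat_vec d M (x + y) i = mat_vec d M x i + mat_vec d M y i"
  by (simp add: mat_vec_def algebra_simps sum.distrib)

lemma mat_vec_scale: "mat_vec d M (scale_seq c x) i = c * mat_vec d M x i"
  by (simp add: mat_vec_def scale_seq_apply sum_distrib_left algebra_simps)

lemma mat_vec_unit_seq: "j < d \<Longrightarrow> mat_vec d M (unit_seq j) i = M i j"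
  by (simp add: mat_vec_def unit_seq_def if_distrib cong: if_cong)

lemma mat_vec_minus: "mat_vec d (- M) x i = - mat_vec d M x i"
  by (simp add: mat_vec_def sum_negf)

lemma subspace_kernel: "seqs.subspace (kernel d M)"
  using subspace_coords[of d] unfolding kernel_def seqs.subspace_def
  by (auto simp: mat_vec_add mat_vec_scale) (simp add: mat_vec_def)

lemma kernel_subset_coords: "kernel d M \<subseteq> coords d"
  by (auto simp: kernel_def)

lemma sesq_add_right: "sesq d M x (y + z) = sesq d M x y + sesq d M x z"
  by (simp add: sesq_def mat_vec_add algebra_simps sum.distrib)

lemma sesq_add_left: "sesq d M (x + y) z = sesq d M x z + sesq d M y z"
  by (simp add: sesq_def algebra_simps sum.distrib)

lemma sesq_scale_right: "sesq d M x (scale_seq c y) = c * sesq d M x y"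
  by (simp add: sesq_def mat_vec_scale sum_distrib_left algebra_simps)

lemma sesq_scale_left: "sesq d M (scale_seq c x) y = cnj c * sesq d M x y"
  by (simp add: sesq_def scale_seq_apply sum_distrib_left algebra_simps)

lemma sesq_zero_right [simp]: "sesq d M x 0 = 0"
  by (simp add: sesq_def mat_vec_def)

lemma sesq_zero_left [simp]: "sesq d M 0 x = 0"
  by (simp add: sesq_def)

lemma sesq_sum_right: "sesq d M x (\<Sum>i\<in>I. g i) = (\<Sum>i\<in>I. sesq d M x (g i))"
  by (induction I rule: infinite_finite_induct) (simp_all only: sum.infinite sum.empty sum.insert sesq_zero_right sesq_add_right not_False_eq_True)

lemma sesq_sum_left: "sesq d M (\<Sum>i\<in>I. g i) x = (\<Sum>i\<in>I. sesq d M (g i) x)"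
  by (induction I rule: infinite_finite_induct) (simp_all only: sum.infinite sum.empty sum.insert sesq_zero_left sesq_add_left not_False_eq_True)

lemma sesq_minus: "sesq d (- M) x y = - sesq d M x y"
  by (simp add: sesq_def mat_vec_minus sum_negf)

lemma sesq_unit_seq: "i < d \<Longrightarrow> sesq d M (unit_seq i) x = mat_vec d M x i"
  by (simp add: sesq_def unit_seq_def if_distrib[of cnj] if_distrib[of "\<lambda>t. t * _"] cong: if_cong)

lemma sesq_kernel: "y \<in> kernel d M \<Longrightarrow> sesq d M x y = 0"
  by (simp add: sesq_def kernel_def)

lemma hermitianI: "(\<And>i j. cnj (M i j) = M j i) \<Longrightarrow> hermitian M"
  unfolding hermitian_def by metis

lemma hermitianD: "hermitian M \<Longrightarrow> cnj (M i j) = M j i"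
  unfolding hermitian_def by metis

lemma hermitian_uminus: "hermitian M \<Longrightarrow> hermitian (- M)"
  by (rule hermitianI) (simp add: hermitianD)

lemma sesq_hermitian:
  assumes "hermitian M"
  shows "sesq d M y x = cnj (sesq d M x y)"
proof -
  have "cnj (sesq d M x y) = (\<Sum>i<d. \<Sum>j<d. x i * cnj (M i j) * cnj (y j))"
    by (simp add: sesq_def mat_vec_def sum_distrib_left algebra_simps)
  also have "\<dots> = (\<Sum>j<d. \<Sum>i<d. x i * cnj (M i j) * cnj (y j))"
    by (rule sum.swap)
  also have "\<dots> = sesq d M y x"
    unfolding sesq_def mat_vec_def sum_distrib_left
  proof (intro sum.cong refl)
    fix i j
    show "x i * cnj (M i j) * cnj (y j) = cnj (y j) * (M j i * x i)"
      using assms by (simp add: hermitianD)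
  qed
  finally show ?thesis by simp
qed

lemma qform_add:
  assumes "hermitian M"
  shows "qform d M (x + y) = qform d M x + qform d M y + 2 * Re (sesq d M x y)"
  using sesq_hermitian[OF assms, of d y x] by (simp add: sesq_add_left sesq_add_right)

lemma qform_add_kernel:
  assumes "hermitian M" "k \<in> kernel d M"
  shows "qform d M (x + k) = qform d M x"
  using assms by (simp add: qform_add sesq_kernel)

section \<open>The negative index and its elementary bounds\<close>

lemma neg_subspace_zero: "neg_subspace d M {0}"
  by (auto simp: neg_subspace_def seqs.subspace_0 coords_def)

lemma finite_neg_dims: "finite (seqs.dim ` {S. neg_subspace d M S})"
  by (rule finite_subset[of _ "{..d}"]) (auto simp: neg_subspace_def dim_le_coords)

lemma neg_index_ge: "neg_subspace d M S \<Longrightarrow> seqs.dim S \<le> neg_index d M"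
  unfolding neg_index_def using finite_neg_dims by (intro Max_ge) auto

lemma neg_index_witness:
  obtains S where "neg_subspace d M S" "seqs.dim S = neg_index d M"
proof -
  have "neg_index d M \<in> seqs.dim ` {S. neg_subspace d M S}"
    unfolding neg_index_def using finite_neg_dims neg_subspace_zero by (intro Max_in) blast+
  then show ?thesis using that by auto
qed

lemma neg_index_mono:
  assumes "\<And>x. x \<in> coords d \<Longrightarrow> qform d M x \<le> qform d M' x"
  shows "neg_index d M' \<le> neg_index d M"
proof -
  obtain S where S: "neg_subspace d M' S" "seqs.dim S = neg_index d M'"
    using neg_index_witness .
  then have "neg_subspace d M S"
    using assms unfolding neg_subspace_def by (meson in_mono order_le_less_trans)
  then show ?thesis using neg_index_ge S by metis
qed

text \<open>The form is nonnegative on the sum of a maximal positive subspace and the kernel. That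
  sum meets a negative subspace only in 0, so the three dimensions add up inside
  \<open>coords d\<close>.\<close>

lemma neg_index_add_le:
  assumes M: "hermitian M"
  shows "neg_index d M + neg_index d (- M) + seqs.dim (kernel d M) \<le> d"
proof -
  obtain S where S: "neg_subspace d M S" "seqs.dim S = neg_index d M"
    using neg_index_witness .
  obtain T where T: "neg_subspace d (- M) T" "seqs.dim T = neg_index d (- M)"
    using neg_index_witness .
  have subs: "seqs.subspace S" "seqs.subspace T" "S \<subseteq> coords d" "T \<subseteq> coords d"
    using S T by (auto simp: neg_subspace_def)
  have neg: "qform d M x < 0" if "x \<in> S" "x \<noteq> 0" for x
    using S that by (simp add: neg_subspace_def)
  have pos: "qform d M x > 0" if "x \<in> T" "x \<noteq> 0" for x
    using T that by (simp add: neg_subspace_def sesq_minus)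
  let ?U = "seqs.span (T \<union> kernel d M)"
  have U: "?U \<subseteq> coords d"
    using subs kernel_subset_coords by (intro seqs.span_minimal subspace_coords) auto
  have "qform d M x = 0" if "x \<in> kernel d M" for x
    using sesq_kernel[OF that] by simp
  then have "T \<inter> kernel d M \<subseteq> {0}"
    using pos by force
  then have 1: "seqs.dim ?U = seqs.dim T + seqs.dim (kernel d M)"
    by (intro dim_span_Un_direct[of T d] subs subspace_kernel kernel_subset_coords)
  have "qform d M x \<ge> 0" if "x \<in> ?U" for x
  proof -
    obtain y k where "x = y + k" "y \<in> T" "k \<in> kernel d M"
      using \<open>x \<in> ?U\<close> unfolding span_Un_subspaces[OF subs(2) subspace_kernel] by blast
    then show ?thesis
      using pos[of y] M by (cases "y = 0") (auto simp: qform_add_kernel sesq_kernel)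
  qed
  then have "S \<inter> ?U \<subseteq> {0}"
    using neg by force
  then have "seqs.dim (seqs.span (S \<union> ?U)) = seqs.dim S + seqs.dim ?U"
    using subs U by (intro dim_span_Un_direct) auto
  moreover have "seqs.dim (seqs.span (S \<union> ?U)) \<le> d"
    using subs U by (intro dim_le_coords seqs.span_minimal subspace_coords) auto
  ultimately show ?thesis
    using 1 S T by simp
qed

section \<open>Orthonormal systems of an indefinite Hermitian form\<close>

definition orthonormal :: "nat \<Rightarrow> (nat \<Rightarrow> nat \<Rightarrow> complex) \<Rightarrow> (nat \<Rightarrow> complex) set \<Rightarrow> bool" where
  "orthonormal d M V \<longleftrightarrow> V \<subseteq> coords d \<and> finite V \<and>
     (\<forall>v\<in>V. sesq d M v v \<in> {1, - 1}) \<and> (\<forall>u\<in>V. \<forall>v\<in>V. u \<noteq> v \<longrightarrow> sesq d M u v = 0)"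

lemma sesq_orthonormal_sum:
  assumes "orthonormal d M V" "u \<in> V"
  shows "sesq d M u (\<Sum>v\<in>V. scale_seq (c v) v) = c u * sesq d M u u"
proof -
  have "sesq d M u (\<Sum>v\<in>V. scale_seq (c v) v) = (\<Sum>v\<in>V. if v = u then c u * sesq d M u u else 0)"
    unfolding sesq_sum_right sesq_scale_right
    using assms by (intro sum.cong refl) (auto simp: orthonormal_def)
  then show ?thesis
    using assms by (simp add: orthonormal_def)
qed

lemma orthonormal_independent:
  assumes "orthonormal d M V"
  shows "seqs.independent V"
proof (rule seqs.independent_if_scalars_zero)
  fix c x assume 0: "(\<Sum>x\<in>V. scale_seq (c x) x) = 0" and "x \<in> V"
  moreover have "sesq d M x x \<noteq> 0"
    using assms \<open>x \<in> V\<close> by (force simp: orthonormal_def)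
  ultimately show "c x = 0"
    using sesq_orthonormal_sum[OF assms \<open>x \<in> V\<close>, of c] by simp
qed (use assms in \<open>simp add: orthonormal_def\<close>)

lemma qform_real: "hermitian M \<Longrightarrow> sesq d M x x = of_real (qform d M x)"
  using sesq_hermitian[of M d x x] by (simp add: complex_eq_iff)

text \<open>Dividing x by the square root of the modulus of its square leaves only the sign of that
  square.\<close>

lemma orthonormal_insert:
  assumes M: "hermitian M" and V: "orthonormal d M V" and x: "x \<in> coords d"
    "\<And>v. v \<in> V \<Longrightarrow> sesq d M v x = 0" "qform d M x \<noteq> 0"
  shows "\<exists>y. y \<notin> V \<and> orthonormal d M (insert y V)"
proof -
  define r where "r = sqrt \<bar>qform d M x\<bar>"
  have r: "r * r = \<bar>qform d M x\<bar>" "r \<noteq> 0"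
    using x(3) by (auto simp: r_def)
  define y where "y = scale_seq (of_real (1 / r)) x"
  define t where "t = qform d M x / (r * r)"
  have "sesq d M y y = of_real t"
    using qform_real[OF M, of d x]
    by (simp add: y_def t_def sesq_scale_left sesq_scale_right)
  moreover have "t \<in> {1, - 1}"
    unfolding t_def r(1) using x(3) by (cases "qform d M x > 0") auto
  ultimately have yy: "sesq d M y y \<in> {1, - 1}"
    by auto
  have vy: "sesq d M v y = 0" if "v \<in> V" for v
    using x(2) that by (simp add: y_def sesq_scale_right)
  have yv: "sesq d M y v = 0" if "v \<in> V" for v
    using vy[OF that] sesq_hermitian[OF M, of d y v] by simp
  have "y \<notin> V"
    using vy[of y] yy by auto
  moreover have "y \<in> coords d"
    using x(1) by (simp add: y_def coords_def scale_seq_apply)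
  ultimately show ?thesis
    using V vy yv yy unfolding orthonormal_def by (intro exI[of _ y]) auto
qed

text \<open>Gram-Schmidt by maximality: the orthogonal complement P of a largest orthonormal system
  contains only vectors of square zero. By polarization the form vanishes on P, so P lies in the
  kernel, and the system together with a basis of the kernel spans everything.\<close>

lemma orthonormal_complete:
  assumes M: "hermitian M"
  obtains V where "orthonormal d M V" "d \<le> card V + seqs.dim (kernel d M)"
proof -
  have "card V \<le> d" if "orthonormal d M V" for V
    using independent_coords_bound[of V d] orthonormal_independent[OF that] that
    by (simp add: orthonormal_def)
  moreover have "orthonormal d M {}"
    by (simp add: orthonormal_def)
  ultimately have "\<exists>V. orthonormal d M V \<and> (\<forall>U. orthonormal d M U \<longrightarrow> card U \<le> card V)"
    by (intro ex_has_greatest_nat[of "orthonormal d M" "{}" card "Suc d"]) (auto simp: less_Suc_eq_le)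
  then obtain V where V: "orthonormal d M V"
    and max: "\<And>U. orthonormal d M U \<Longrightarrow> card U \<le> card V"
    by blast
  have finV: "finite V" "V \<subseteq> coords d" using V by (auto simp: orthonormal_def)
  define P where "P = {x \<in> coords d. \<forall>v\<in>V. sesq d M v x = 0}"
  have P_add: "x + scale_seq c y \<in> P" if "x \<in> P" "y \<in> P" for x y c
    using that by (simp add: P_def coords_def scale_seq_apply sesq_add_right sesq_scale_right)
  have null: "qform d M x = 0" if "x \<in> P" for x
  proof (rule ccontr)
    assume "qform d M x \<noteq> 0"
    then obtain y where "y \<notin> V" "orthonormal d M (insert y V)"
      using orthonormal_insert[OF M V, of x] \<open>x \<in> P\<close> by (auto simp: P_def)
    then show False using max[of "insert y V"] finV by simp
  qed
  have null2: "sesq d M x y = 0" if "x \<in> P" "y \<in> P" for x y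
  proof -
    \<comment> \<open>This scalar turns the cross term of the polarization into a squared
      modulus.\<close>
    let ?c = "cnj (sesq d M x y)"
    have "0 = qform d M (x + scale_seq ?c y)"
      using null P_add that by simp
    also have "\<dots> = 2 * Re (?c * sesq d M x y)"
      using null[OF that(1)] null[OF that(2)] qform_real[OF M, of d y]
      by (simp add: qform_add[OF M] sesq_scale_left sesq_scale_right)
    also have "?c * sesq d M x y = of_real ((cmod (sesq d M x y))\<^sup>2)"
      using complex_norm_square[of "sesq d M x y"] by (simp add: mult.commute)
    also have "2 * Re \<dots> = 2 * (cmod (sesq d M x y))\<^sup>2"
      by (simp only: Re_complex_of_real)
    finally show ?thesis by simp
  qed
  have decomp: "\<exists>u\<in>seqs.span V. \<exists>p\<in>P. y = u + p \<and> (\<forall>x\<in>P. sesq d M x u = 0)" if "y \<in> coords d" for y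
  proof -
    \<comment> \<open>The orthogonal projection of y to the span of V; the division accounts for
      vectors of square -1.\<close>
    define u where "u = (\<Sum>v\<in>V. scale_seq (sesq d M v y / sesq d M v v) v)"
    have u: "u \<in> seqs.span V"
      unfolding u_def by (intro seqs.span_sum seqs.span_scale seqs.span_base)
    then have uc: "u \<in> coords d"
      using seqs.span_minimal[OF finV(2) subspace_coords] by blast
    have vv: "sesq d M v v \<noteq> 0" if "v \<in> V" for v
      using V that by (force simp: orthonormal_def)
    have "sesq d M v u = sesq d M v y" if "v \<in> V" for v
      unfolding u_def sesq_orthonormal_sum[OF V that] using vv[OF that] by simp
    then have "y - u \<in> P"
      using that uc sesq_add_right[of d M _ "y - u" u] by (auto simp: P_def coords_def)
    moreover have "sesq d M x u = 0" if "x \<in> P" for x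
    proof -
      have "sesq d M x v = 0" if "v \<in> V" for v
        using \<open>x \<in> P\<close> that sesq_hermitian[OF M, of d x v] by (simp add: P_def)
      then show ?thesis
        by (simp add: u_def sesq_sum_right sesq_scale_right)
    qed
    ultimately show ?thesis using u by (metis add.commute diff_add_cancel)
  qed
  have "P \<subseteq> kernel d M"
  proof
    fix x assume x: "x \<in> P"
    have "sesq d M x y = 0" if "y \<in> coords d" for y
      using decomp[OF that] null2[OF x] x by (auto simp: sesq_add_right)
    then have "mat_vec d M x i = 0" if "i < d" for i
      using sesq_unit_seq[OF that, of M x] unit_seq_in_coords[OF that]
        sesq_hermitian[OF M, of d "unit_seq i" x] by simp
    then show "x \<in> kernel d M"
      using x by (simp add: kernel_def P_def)
  qed
  obtain K where K: "K \<subseteq> kernel d M" "kernel d M \<subseteq> seqs.span K" "finite K"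
    "card K = seqs.dim (kernel d M)"
    using coords_basis[OF kernel_subset_coords] by metis
  have "coords d \<subseteq> seqs.span (V \<union> K)"
  proof
    fix y assume "y \<in> coords d"
    then obtain u p where "y = u + p" "u \<in> seqs.span V" "p \<in> P" using decomp by blast
    then have "y = u + p" "u \<in> seqs.span (V \<union> K)" "p \<in> seqs.span (V \<union> K)"
      using \<open>P \<subseteq> kernel d M\<close> K(2) seqs.span_mono[of V "V \<union> K"] seqs.span_mono[of K "V \<union> K"] by blast+
    then show "y \<in> seqs.span (V \<union> K)" by (simp add: seqs.span_add)
  qed
  then have "d \<le> card (V \<union> K)"
    using seqs.dim_le_card[of "coords d" "V \<union> K"] finV K(3) by (simp add: dim_coords)
  also have "\<dots> \<le> card V + card K" by (rule card_Un_le)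
  finally show ?thesis using that V K(4) by simp
qed

section \<open>Stability of the negative index under perturbation\<close>

lemma sesq_tendsto:
  assumes "\<And>i j. ((\<lambda>p. M p i j) \<longlongrightarrow> M0 i j) F"
  shows "((\<lambda>p. sesq d (M p) x y) \<longlongrightarrow> sesq d M0 x y) F"
  unfolding sesq_def mat_vec_def by (intro tendsto_intros assms)

text \<open>Write the Gram matrix of the m vectors as -I + E. As the entries of E are below 1/m, the
  bound 2|c_u||c_v| <= |c_u|^2 + |c_v|^2 keeps the contribution of E below the sum of all |c_u|^2,
  which is what -I takes away.\<close>

lemma orthonormal_negative_perturbation:
  assumes V: "V \<subseteq> coords d" "finite V"
    and near: "\<And>u v. u \<in> V \<Longrightarrow> v \<in> V \<Longrightarrow>
      cmod (sesq d M u v - (if u = v then - 1 else 0)) < 1 / real (card V)"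
  shows "neg_subspace d M (seqs.span V)"
  unfolding neg_subspace_def
proof (intro conjI ballI impI)
  show "seqs.span V \<subseteq> coords d"
    using V by (intro seqs.span_minimal subspace_coords)
  fix x assume "x \<in> seqs.span V" "x \<noteq> 0"
  then obtain c where x: "x = (\<Sum>v\<in>V. scale_seq (c v) v)"
    using V(2) by (auto simp: seqs.span_finite)
  define m where "m = real (card V)"
  define e where "e u v = sesq d M u v - (if u = v then - 1 else 0)" for u v
  obtain v0 where v0: "v0 \<in> V" "c v0 \<noteq> 0"
    using \<open>x \<noteq> 0\<close> x by (metis (no_types, lifting) seqs.scale_zero_left sum.neutral)
  have m: "m > 0" using v0 V(2) by (auto simp: m_def card_gt_0_iff)
  have "sesq d M x x = (\<Sum>u\<in>V. \<Sum>v\<in>V. cnj (c u) * c v * sesq d M u v)"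
    unfolding x sesq_sum_left unfolding sesq_sum_right sesq_scale_left sesq_scale_right
    by (simp add: ac_simps)
  also have "\<dots> = (\<Sum>u\<in>V. \<Sum>v\<in>V. cnj (c u) * c v * e u v - (if v = u then cnj (c u) * c u else 0))"
  proof (intro sum.cong refl)
    fix u v
    show "cnj (c u) * c v * sesq d M u v
        = cnj (c u) * c v * e u v - (if v = u then cnj (c u) * c u else 0)"
      by (cases "u = v") (simp_all add: e_def ring_distribs)
  qed
  also have "\<dots> = (\<Sum>u\<in>V. \<Sum>v\<in>V. cnj (c u) * c v * e u v) - (\<Sum>u\<in>V. cnj (c u) * c u)"
    using V(2) by (simp add: sum_subtractf)
  also have "(\<Sum>u\<in>V. cnj (c u) * c u) = of_real (\<Sum>u\<in>V. (cmod (c u))\<^sup>2)"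
    unfolding of_real_sum by (intro sum.cong refl) (metis complex_norm_square mult.commute of_real_power)
  finally have eq: "qform d M x = Re (\<Sum>u\<in>V. \<Sum>v\<in>V. cnj (c u) * c v * e u v) - (\<Sum>u\<in>V. (cmod (c u))\<^sup>2)"
    by (simp only: minus_complex.sel Re_complex_of_real)
  have "Re (\<Sum>u\<in>V. \<Sum>v\<in>V. cnj (c u) * c v * e u v)
      \<le> (\<Sum>u\<in>V. \<Sum>v\<in>V. cmod (c u) * cmod (c v) * cmod (e u v))"
    by (rule order_trans[OF complex_Re_le_cmod])
       (auto intro!: order_trans[OF norm_sum] sum_mono simp: norm_mult)
  also have "\<dots> < (\<Sum>u\<in>V. \<Sum>v\<in>V. ((cmod (c u))\<^sup>2 + (cmod (c v))\<^sup>2) / (2 * m))"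
  proof -
    have le: "cmod (c u) * cmod (c v) * cmod (e u v) \<le> ((cmod (c u))\<^sup>2 + (cmod (c v))\<^sup>2) / (2 * m)"
      if "u \<in> V" "v \<in> V" for u v
    proof -
      have "cmod (c u) * cmod (c v) * cmod (e u v) \<le> cmod (c u) * cmod (c v) * (1 / m)"
        using near[OF that] by (intro mult_left_mono) (auto simp: e_def m_def)
      also have "\<dots> \<le> ((cmod (c u))\<^sup>2 + (cmod (c v))\<^sup>2) / 2 * (1 / m)"
        using m sum_squares_bound[of "cmod (c u)" "cmod (c v)"] by (intro mult_right_mono) auto
      finally show ?thesis by simp
    qed
    \<comment> \<open>Strictness comes from the diagonal term of a nonzero coefficient.\<close>
    have lt: "cmod (c v0) * cmod (c v0) * cmod (e v0 v0) < ((cmod (c v0))\<^sup>2 + (cmod (c v0))\<^sup>2) / (2 * m)"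
    proof -
      have "cmod (c v0) * cmod (c v0) * cmod (e v0 v0) < cmod (c v0) * cmod (c v0) * (1 / m)"
        using near[OF v0(1) v0(1)] v0(2) by (intro mult_strict_left_mono) (auto simp: e_def m_def)
      then show ?thesis by (simp add: power2_eq_square)
    qed
    show ?thesis
    proof (rule sum_strict_mono_ex1)
      show "\<exists>u\<in>V. (\<Sum>v\<in>V. cmod (c u) * cmod (c v) * cmod (e u v))
          < (\<Sum>v\<in>V. ((cmod (c u))\<^sup>2 + (cmod (c v))\<^sup>2) / (2 * m))"
        using v0(1) le lt V(2) by (intro bexI[of _ v0] sum_strict_mono_ex1) auto
    qed (use le V(2) in \<open>auto intro!: sum_mono\<close>)
  qed
  also have "\<dots> = (\<Sum>u\<in>V. (cmod (c u))\<^sup>2)"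
  proof -
    have "(\<Sum>u\<in>V. \<Sum>v\<in>V. ((cmod (c u))\<^sup>2 + (cmod (c v))\<^sup>2) / (2 * m))
        = (m * (\<Sum>u\<in>V. (cmod (c u))\<^sup>2) + m * (\<Sum>u\<in>V. (cmod (c u))\<^sup>2)) / (2 * m)"
      by (simp add: sum.distrib m_def flip: sum_divide_distrib sum_distrib_left)
    then show ?thesis using m by (simp add: field_simps)
  qed
  finally show "qform d M x < 0" using eq by simp
qed simp

text \<open>The case of zero error in the perturbation estimate.\<close>

lemma orthonormal_negative_part:
  assumes "orthonormal d M V"
  shows "neg_subspace d M (seqs.span {v \<in> V. sesq d M v v = - 1})"
  using assms
  by (intro orthonormal_negative_perturbation) (auto simp: orthonormal_def card_gt_0_iff)

lemma dim_span_orthonormal_part: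
  assumes "orthonormal d M V" "U \<subseteq> V"
  shows "seqs.dim (seqs.span U) = card U"
  using assms seqs.independent_mono[OF orthonormal_independent[OF assms(1)] assms(2)]
  by (intro seqs.dim_span_eq_card_independent)

text \<open>The negative and the positive members of a complete orthonormal system bound the two
  indices from below, and \<open>neg_index_add_le\<close> bounds their sum from above. Hence all
  these inequalities are equalities, and the negative members span a negative subspace of maximal
  dimension.\<close>

lemma negative_orthonormal_basis:
  assumes M: "hermitian M"
  obtains V where "V \<subseteq> coords d" "finite V" "card V = neg_index d M" "seqs.independent V"
    "\<And>u v. u \<in> V \<Longrightarrow> v \<in> V \<Longrightarrow> sesq d M u v = (if u = v then - 1 else 0)"
    "neg_index d M + neg_index d (- M) + seqs.dim (kernel d M) = d"
proof -
  obtain V where V: "orthonormal d M V" "d \<le> card V + seqs.dim (kernel d M)"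
    using orthonormal_complete[OF M] .
  define A where "A = {v \<in> V. sesq d M v v = - 1}"
  define B where "B = {v \<in> V. sesq d (- M) v v = - 1}"
  have V': "orthonormal d (- M) V"
    using V(1) by (auto simp: orthonormal_def sesq_minus)
  have AB: "A \<union> B = V" "A \<inter> B = {}"
    using V(1) by (auto simp: A_def B_def orthonormal_def sesq_minus)
  then have card: "card V = card A + card B"
    using V(1) by (metis card_Un_disjoint finite_Un orthonormal_def)
  have A: "card A \<le> neg_index d M"
    using neg_index_ge[OF orthonormal_negative_part[OF V(1)]] dim_span_orthonormal_part[OF V(1), of A]
    by (simp add: A_def)
  have B: "card B \<le> neg_index d (- M)"
    using neg_index_ge[OF orthonormal_negative_part[OF V']] dim_span_orthonormal_part[OF V', of B]
    by (simp add: B_def)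
  show ?thesis
  proof (rule that[of A])
    show "card A = neg_index d M"
      "neg_index d M + neg_index d (- M) + seqs.dim (kernel d M) = d"
      using neg_index_add_le[OF M, of d] V(2) A B card by linarith+
    show "seqs.independent A"
      using orthonormal_independent[OF V(1)] AB by (metis Un_upper1 seqs.independent_mono)
  qed (use V(1) in \<open>auto simp: A_def orthonormal_def\<close>)
qed

theorem inertia:
  assumes "hermitian M"
  shows "neg_index d M + neg_index d (- M) + seqs.dim (kernel d M) = d"
  using negative_orthonormal_basis[OF assms] by metis

text \<open>The nearby forms are tested on a fixed orthonormal basis of a maximal negative subspace
  of \<open>M0\<close>; its finitely many Gram entries converge to those of minus the
  identity.\<close>

theorem neg_index_lower_semicontinuous:
  assumes M0: "hermitian M0" and lim: "\<And>i j. ((\<lambda>p. M p i j) \<longlongrightarrow> M0 i j) F"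
  shows "\<forall>\<^sub>F p in F. neg_index d M0 \<le> neg_index d (M p)"
proof -
  obtain V where V: "V \<subseteq> coords d" "finite V" "card V = neg_index d M0" "seqs.independent V"
    and on: "\<And>u v. u \<in> V \<Longrightarrow> v \<in> V \<Longrightarrow> sesq d M0 u v = (if u = v then - 1 else 0)"
    by (rule negative_orthonormal_basis[OF M0, of d], rule that)
  show ?thesis
  proof (cases "V = {}")
    case True
    then show ?thesis using V(3) by simp
  next
    case False
    then have m: "1 / real (card V) > 0"
      using V(2) by (simp add: card_gt_0_iff)
    have "\<forall>\<^sub>F p in F. \<forall>u\<in>V. \<forall>v\<in>V. dist (sesq d (M p) u v) (sesq d M0 u v) < 1 / real (card V)"
      using V(2) m
      by (intro eventually_ball_finite ballI tendstoD sesq_tendsto lim)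
    then show ?thesis
    proof eventually_elim
      case (elim p)
      then have "neg_subspace d (M p) (seqs.span V)"
        using V(1,2) on by (intro orthonormal_negative_perturbation) (auto simp: dist_norm)
      moreover have "seqs.dim (seqs.span V) = neg_index d M0"
        using V(3,4) by (simp add: seqs.dim_eq_card_independent)
      ultimately show ?case using neg_index_ge by metis
    qed
  qed
qed

section \<open>Index bounds for diagonal, rescaled and hyperbolic forms\<close>

lemma neg_index_diag:
  "card {i. i < d \<and> D i < 0} \<le> neg_index d (\<lambda>i j. if i = j then of_real (D i) else 0)"
proof -
  define I where "I = {i. i < d \<and> D i < 0}"
  define M where "M = (\<lambda>i j. if i = j then complex_of_real (D i) else 0)"
  have fin: "finite I" by (simp add: I_def)
  have mv: "mat_vec d M x i = of_real (D i) * x i" if "i < d" for x i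
    using that by (simp add: mat_vec_def M_def if_distrib[of "\<lambda>t. t * _"] cong: if_cong)
  have q: "qform d M x = (\<Sum>i<d. D i * (cmod (x i))\<^sup>2)" for x
  proof -
    have "sesq d M x x = (\<Sum>i<d. of_real (D i * (cmod (x i))\<^sup>2))"
      unfolding sesq_def
    proof (intro sum.cong refl)
      fix i assume "i \<in> {..<d}"
      then show "cnj (x i) * mat_vec d M x i = of_real (D i * (cmod (x i))\<^sup>2)"
        using complex_norm_square[of "x i"] by (simp add: mv)
    qed
    then show ?thesis by simp
  qed
  have "seqs.subspace {x \<in> coords d. \<forall>i. i \<notin> I \<longrightarrow> x i = 0}"
    using subspace_coords[of d] by (auto simp: seqs.subspace_def scale_seq_apply)
  moreover have "unit_seq ` I \<subseteq> {x \<in> coords d. \<forall>i. i \<notin> I \<longrightarrow> x i = 0}"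
    by (auto simp: I_def unit_seq_in_coords) (auto simp: unit_seq_def)
  ultimately have sub: "seqs.span (unit_seq ` I) \<subseteq> {x \<in> coords d. \<forall>i. i \<notin> I \<longrightarrow> x i = 0}"
    by (rule seqs.span_minimal[rotated])
  have "neg_subspace d M (seqs.span (unit_seq ` I))"
    unfolding neg_subspace_def
  proof (intro conjI ballI impI)
    show "seqs.span (unit_seq ` I) \<subseteq> coords d" using sub by blast
    fix x assume "x \<in> seqs.span (unit_seq ` I)" and "x \<noteq> 0"
    then have x: "\<And>i. i \<notin> I \<Longrightarrow> x i = 0" and "\<exists>i. x i \<noteq> 0"
      using sub by (auto simp: fun_eq_iff)
    then obtain i where i: "x i \<noteq> 0" "i \<in> I" by blast
    have "0 < (\<Sum>i<d. - (D i * (cmod (x i))\<^sup>2))"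
    proof (rule sum_pos2)
      show "0 < - (D i * (cmod (x i))\<^sup>2)"
        using i by (simp add: I_def mult_neg_pos)
      show "0 \<le> - (D j * (cmod (x j))\<^sup>2)" if "j \<in> {..<d}" for j
        using x[of j] that by (cases "j \<in> I") (auto simp: I_def mult_nonpos_nonneg)
    qed (use i in \<open>auto simp: I_def\<close>)
    then show "qform d M x < 0" by (simp add: q sum_negf)
  qed simp
  then have "seqs.dim (seqs.span (unit_seq ` I)) \<le> neg_index d M"
    by (rule neg_index_ge)
  then show ?thesis
    using fin by (simp add: dim_span_unit_seqs I_def M_def del: seqs.dim_span)
qed

text \<open>Scaling the coordinates by r carries a negative subspace of the rescaled form to one of
  M of the same dimension. This half of Sylvester's law brings a lower bound for a rescaled pencil
  back to the pencil itself.\<close>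

lemma neg_index_congruence:
  fixes r :: "nat \<Rightarrow> real"
  assumes r: "\<And>i. r i \<noteq> 0"
  shows "neg_index d (\<lambda>i j. of_real (r i) * M i j * of_real (r j)) \<le> neg_index d M"
    (is "neg_index d ?M' \<le> _")
proof -
  define g where "g = (\<lambda>(x :: nat \<Rightarrow> complex) i. of_real (r i) * x i)"
  have lin: "Vector_Spaces.linear scale_seq scale_seq g"
    by (simp add: Vector_Spaces.linear_iff vector_space_scale_seq) (auto simp: g_def scale_seq_apply fun_eq_iff algebra_simps)
  have inj: "inj g"
    using r by (auto simp: inj_def g_def fun_eq_iff)
  have q: "sesq d ?M' x x = sesq d M (g x) (g x)" for x
    by (simp add: sesq_def mat_vec_def g_def sum_distrib_left algebra_simps)
  obtain S where S: "neg_subspace d ?M' S" "seqs.dim S = neg_index d ?M'"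
    using neg_index_witness .
  then have sub: "seqs.subspace S" "S \<subseteq> coords d" by (auto simp: neg_subspace_def)
  have "neg_subspace d M (g ` S)"
    unfolding neg_subspace_def
  proof (intro conjI ballI impI)
    show "seqs.subspace (g ` S)"
      using lin sub(1) by (rule seqs.linear_subspace_image)
    show "g ` S \<subseteq> coords d"
      using sub(2) by (auto simp: coords_def g_def)
    fix y assume "y \<in> g ` S" "y \<noteq> 0"
    then obtain x where x: "x \<in> S" "y = g x"
      by blast
    moreover have "x \<noteq> 0"
      using \<open>y \<noteq> 0\<close> x(2) by (auto simp: g_def fun_eq_iff)
    ultimately have "qform d ?M' x < 0"
      using S(1) by (auto simp: neg_subspace_def)
    then show "qform d M y < 0"
      unfolding q x(2) .
  qed
  then have "seqs.dim (g ` S) \<le> neg_index d M" by (rule neg_index_ge)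
  moreover have "seqs.dim (g ` S) = seqs.dim S"
    using lin sub(1) inj_on_subset[OF inj subset_UNIV] by (rule dim_linear_image_inj_on)
  ultimately show ?thesis using S(2) by simp
qed

lemma Re_of_real_mult: "Re (of_real a * z) = a * Re z"
  by simp

text \<open>The first basis vector is isotropic or negative and is coupled to the second. A large
  multiple of it therefore makes the form negative somewhere on their plane, whatever the second
  diagonal entry is.\<close>

lemma neg_index_hyperbolic:
  assumes M: "hermitian M" and d: "2 \<le> d" and "Re (M 0 0) \<le> 0" and "M 0 1 \<noteq> 0"
  shows "1 \<le> neg_index d M"
proof -
  \<comment> \<open>With this s, twice the real part of the cross term is -(|Re M11| + 1), which
    outweighs the entry \<open>M 1 1\<close>.\<close>
  define s where "s = (\<bar>Re (M 1 1)\<bar> + 1) / (2 * (cmod (M 0 1))\<^sup>2)"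
  define \<alpha> where "\<alpha> = - of_real s * M 0 1"
  define x where "x = scale_seq \<alpha> (unit_seq 0) + unit_seq 1"
  have x: "x \<in> coords d" using d by (auto simp: x_def coords_def unit_seq_def scale_seq_apply)
  have "s * (cmod (M 0 1))\<^sup>2 = (\<bar>Re (M 1 1)\<bar> + 1) / 2"
    using assms(4) by (simp add: s_def)
  moreover have "cnj \<alpha> * M 0 1 = of_real (- (s * (cmod (M 0 1))\<^sup>2))"
    unfolding \<alpha>_def using complex_norm_square[of "M 0 1"] by (simp add: mult.commute)
  ultimately have cross: "2 * Re (cnj \<alpha> * M 0 1) = - \<bar>Re (M 1 1)\<bar> - 1"
    by simp
  have "cnj \<alpha> * \<alpha> * M 0 0 = of_real ((cmod \<alpha>)\<^sup>2) * M 0 0"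
    using complex_norm_square[of \<alpha>] by (simp add: mult.commute)
  then have sq: "Re (cnj \<alpha> * \<alpha> * M 0 0) = (cmod \<alpha>)\<^sup>2 * Re (M 0 0)"
    by (simp only: Re_of_real_mult)
  have "qform d M x = Re (cnj \<alpha> * \<alpha> * M 0 0) + Re (M 1 1) + 2 * Re (cnj \<alpha> * M 0 1)"
    using d unfolding x_def qform_add[OF M]
    by (simp add: sesq_scale_left sesq_scale_right sesq_unit_seq mat_vec_unit_seq algebra_simps)
  also have "\<dots> < 0"
    unfolding cross sq using mult_nonneg_nonpos[OF zero_le_power2[of "cmod \<alpha>"] assms(3)] by linarith
  finally have neg: "qform d M x < 0" .
  have "neg_subspace d M (seqs.span {x})"
    unfolding neg_subspace_def
  proof (intro conjI ballI impI)
    show "seqs.span {x} \<subseteq> coords d"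
      using x by (intro seqs.span_minimal subspace_coords) simp
    fix y assume "y \<in> seqs.span {x}" "y \<noteq> 0"
    then obtain c where c: "y = scale_seq c x" "c \<noteq> 0"
      by (auto simp: seqs.span_singleton)
    have "cnj c * c = of_real ((cmod c)\<^sup>2)"
      using complex_norm_square[of c] by (simp add: mult.commute)
    moreover have "sesq d M y y = (cnj c * c) * sesq d M x x"
      by (simp add: c(1) sesq_scale_left sesq_scale_right)
    ultimately have "sesq d M y y = of_real ((cmod c)\<^sup>2) * sesq d M x x"
      by (simp only:)
    then have "qform d M y = (cmod c)\<^sup>2 * qform d M x"
      by (simp only: Re_of_real_mult)
    then show "qform d M y < 0"
      using neg c(2) by (simp add: mult_pos_neg)
  qed simp
  moreover have "x \<noteq> 0" using neg by auto
  then have "seqs.dim (seqs.span {x}) = 1"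
    using seqs.dim_eq_card_independent[of "{x}"] by simp
  ultimately show ?thesis using neg_index_ge by metis
qed

section \<open>Eigenvalues of a Hermitian pencil\<close>

definition pencil :: "(nat \<Rightarrow> nat \<Rightarrow> complex) \<Rightarrow> (nat \<Rightarrow> real) \<Rightarrow> complex \<Rightarrow> nat \<Rightarrow> nat \<Rightarrow> complex" where
  "pencil H w l = (\<lambda>i j. H i j - (if i = j then l * of_real (w i) else 0))"

lemma hermitian_pencil: "hermitian H \<Longrightarrow> hermitian (pencil H w (of_real t))"
  by (rule hermitianI) (simp add: pencil_def hermitianD)

lemma mat_vec_pencil:
  "i < d \<Longrightarrow> mat_vec d (pencil H w l) x i = mat_vec d H x i - l * of_real (w i) * x i"
  by (simp add: mat_vec_def pencil_def left_diff_distrib sum_subtractf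
      if_distrib[of "\<lambda>t. t * _"] cong: if_cong)

lemma sesq_pencil:
  "sesq d (pencil H w l) x x = sesq d H x x - l * of_real (\<Sum>i<d. w i * (cmod (x i))\<^sup>2)"
proof -
  have "sesq d (pencil H w l) x x
      = (\<Sum>i<d. cnj (x i) * mat_vec d H x i - l * of_real (w i * (cmod (x i))\<^sup>2))"
    unfolding sesq_def
  proof (intro sum.cong refl)
    fix i assume i: "i \<in> {..<d}"
    have "cnj (x i) * x i = of_real ((cmod (x i))\<^sup>2)"
      using complex_norm_square[of "x i"] by (simp add: mult.commute)
    then show "cnj (x i) * mat_vec d (pencil H w l) x i
        = cnj (x i) * mat_vec d H x i - l * of_real (w i * (cmod (x i))\<^sup>2)"
      using i by (simp add: mat_vec_pencil algebra_simps)
  qed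
  then show ?thesis
    by (simp add: sesq_def sum_subtractf sum_distrib_left)
qed

lemma qform_pencil:
  "qform d (pencil H w (of_real t)) x = qform d H x - t * (\<Sum>i<d. w i * (cmod (x i))\<^sup>2)"
  by (simp add: sesq_pencil del: of_real_sum)

lemma minus_pencil: "- pencil H w l = pencil (- H) w (- l)"
  by (auto simp: pencil_def fun_eq_iff)

text \<open>After multiplying the coordinates i > 0 by 1/sqrt(-t), the form -H + tW tends to the
  diagonal form with entries \<open>- H 0 0\<close> and \<open>- w i\<close>. Its negative squares
  are counted directly; lower semicontinuity and \<open>neg_index_congruence\<close> carry the count
  back to the pencil.\<close>

lemma pos_index_pencil_at_bot:
  assumes H: "hermitian H" and w: "w 0 = 0" "\<And>i. 0 < i \<Longrightarrow> i < d \<Longrightarrow> 0 < w i" and d: "0 < d"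
  shows "\<forall>\<^sub>F t in at_bot. d - 1 + (if Re (H 0 0) > 0 then 1 else 0) \<le> neg_index d (- pencil H w (of_real t))"
proof -
  define D where "D i = (if i = 0 then - Re (H 0 0) else - w i)" for i
  \<comment> \<open>Coordinate 0 has no weight and stays unscaled, so \<open>H 0 0\<close> survives
    in the limit while the other entries of H are damped.\<close>
  define r where "r t i = (if i = 0 then 1 else 1 / sqrt (- t))" for t :: real and i :: nat
  define M0 where "M0 = (\<lambda>i j. if i = j then complex_of_real (D i) else 0)"
  define M where "M t = (\<lambda>i j. of_real (r t i) * (- pencil H w (of_real t)) i j * of_real (r t j))" for t
  have H00: "complex_of_real (Re (H 0 0)) = H 0 0"
    using hermitianD[OF H, of 0 0] by (simp add: complex_eq_iff)
  have sqrt_lim: "filterlim (\<lambda>t::real. sqrt (- t)) at_top at_bot"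
    using filterlim_compose[OF sqrt_at_top filterlim_uminus_at_top_at_bot] .
  have r_lim: "((\<lambda>t. r t i) \<longlongrightarrow> (if i = 0 then 1 else 0)) at_bot" for i
    using tendsto_divide_0[OF tendsto_const filterlim_at_top_imp_at_infinity[OF sqrt_lim], of 1]
    by (simp add: r_def)
  have "((\<lambda>t. M t i j) \<longlongrightarrow> M0 i j) at_bot" for i j
  proof -
    have "((\<lambda>t. - (of_real (r t i) * H i j * of_real (r t j)) - (if i = j then of_real (w i) else 0)) \<longlongrightarrow>
        - (of_real (if i = 0 then 1 else 0) * H i j * of_real (if j = 0 then 1 else 0))
        - (if i = j then of_real (w i) else 0)) at_bot"
      by (intro tendsto_intros r_lim)
    also have "- (of_real (if i = 0 then 1 else 0) * H i j * of_real (if j = 0 then 1 else 0))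
        - (if i = j then of_real (w i) else 0) = M0 i j"
      using H00 w(1) by (auto simp: M0_def D_def)
    finally show ?thesis
    proof (rule Lim_transform_eventually)
      show "\<forall>\<^sub>F t in at_bot. - (of_real (r t i) * H i j * of_real (r t j))
          - (if i = j then of_real (w i) else 0) = M t i j"
        using eventually_gt_at_bot[of 0]
      proof eventually_elim
        case (elim t)
        then have "complex_of_real (sqrt (- t)) * of_real (sqrt (- t)) = - of_real t"
          by (simp flip: of_real_mult)
        then show ?case
          using elim w(1) by (auto simp: M_def r_def pencil_def field_simps)
      qed
    qed
  qed
  moreover have "hermitian M0"
    by (rule hermitianI) (simp add: M0_def)
  ultimately have "\<forall>\<^sub>F t in at_bot. neg_index d M0 \<le> neg_index d (M t)"
    by (intro neg_index_lower_semicontinuous)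
  then show ?thesis
    using eventually_gt_at_bot[of 0]
  proof eventually_elim
    case (elim t)
    have "{i. i < d \<and> D i < 0} = {1..<d} \<union> (if Re (H 0 0) > 0 then {0} else {})"
      using d w(2) by (auto simp: D_def Suc_le_eq)
    moreover have "card ({1..<d} \<union> (if Re (H 0 0) > 0 then {0} else {}))
        = d - 1 + (if Re (H 0 0) > 0 then 1 else 0)"
      using d by auto
    ultimately have "d - 1 + (if Re (H 0 0) > 0 then 1 else 0) \<le> neg_index d M0"
      using neg_index_diag[of d D] by (simp add: M0_def)
    also have "\<dots> \<le> neg_index d (M t)" by (rule elim(1))
    also have "\<dots> \<le> neg_index d (- pencil H w (of_real t))"
      unfolding M_def by (rule neg_index_congruence) (use elim(2) in \<open>auto simp: r_def\<close>)
    finally show ?case .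
  qed
qed

text \<open>The weight degenerates at index 0. The condition \<open>H 0 1 \<noteq> 0\<close> couples
  that direction to index 1 and keeps the first basis vector out of every kernel.\<close>

locale bordered_pencil =
  fixes d :: nat and H :: "nat \<Rightarrow> nat \<Rightarrow> complex" and w :: "nat \<Rightarrow> real"
  assumes d: "2 \<le> d" and H: "hermitian H" and H01: "H 0 1 \<noteq> 0"
    and w0: "w 0 = 0" and w_pos: "\<And>i. 0 < i \<Longrightarrow> i < d \<Longrightarrow> 0 < w i"
begin

abbreviation mult :: "real \<Rightarrow> nat" where
  "mult t \<equiv> seqs.dim (kernel d (pencil H w (of_real t)))"

abbreviation nidx :: "real \<Rightarrow> nat" where
  "nidx t \<equiv> neg_index d (pencil H w (of_real t))"

abbreviation pidx :: "real \<Rightarrow> nat" where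
  "pidx t \<equiv> neg_index d (- pencil H w (of_real t))"

definition mass :: "(nat \<Rightarrow> complex) \<Rightarrow> real" where
  "mass x = (\<Sum>i<d. w i * (cmod (x i))\<^sup>2)"

lemma w_nonneg: "i < d \<Longrightarrow> 0 \<le> w i"
  using w0 w_pos[of i] by (cases "i = 0") auto

lemma mass_nonneg: "0 \<le> mass x"
  unfolding mass_def using w_nonneg by (intro sum_nonneg) auto

text \<open>A vector of mass zero is supported at index 0, and then row 1 of the kernel equation
  reads \<open>H 1 0 * x 0 = 0\<close>.\<close>

lemma mass_kernel_pos:
  assumes x: "x \<in> kernel d (pencil H w l)" "x \<noteq> 0"
  shows "0 < mass x"
proof (rule ccontr)
  assume "\<not> 0 < mass x"
  then have "(\<Sum>i<d. w i * (cmod (x i))\<^sup>2) = 0"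
    using mass_nonneg[of x] by (simp add: mass_def)
  then have "\<forall>i\<in>{..<d}. w i * (cmod (x i))\<^sup>2 = 0"
    by (subst (asm) sum_nonneg_eq_0_iff) (auto simp: w_nonneg)
  then have xi: "x i = 0" if "0 < i" for i
    using w_pos[OF that] x(1) by (cases "i < d") (force simp: kernel_def coords_def)+
  have "mat_vec d (pencil H w l) x 1 = 0"
    using x(1) d by (simp add: kernel_def)
  moreover have "mat_vec d (pencil H w l) x 1 = (\<Sum>j<d. if j = 0 then H 1 0 * x 0 else 0)"
    unfolding mat_vec_def using xi by (intro sum.cong) (auto simp: pencil_def)
  moreover have "\<dots> = H 1 0 * x 0"
    using d by simp
  moreover have "H 1 0 \<noteq> 0"
    using H01 hermitianD[OF H, of 0 1] by auto
  ultimately have "x 0 = 0" by simp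
  then have "x = 0" using xi by (metis ext neq0_conv zero_fun_apply)
  then show False using x(2) by simp
qed

text \<open>Pairing the kernel equation with x shows that l times the positive mass of x is the real
  number \<open>qform d H x\<close>.\<close>

lemma eigenvalue_real:
  assumes "x \<in> kernel d (pencil H w l)" "x \<noteq> 0"
  shows "l \<in> \<real>"
proof -
  have "of_real (qform d H x) = l * of_real (mass x)"
    using sesq_pencil[of d H w l x] sesq_kernel[OF assms(1), of x]
    unfolding qform_real[OF H, of d x, symmetric] mass_def by simp
  moreover have "complex_of_real (mass x) \<noteq> 0"
    using mass_kernel_pos[OF assms] by simp
  ultimately have "l = of_real (qform d H x) / of_real (mass x)"
    by (metis nonzero_mult_div_cancel_right)
  then show ?thesis by (simp only: Reals_divide Reals_of_real)
qed

section \<open>Monotonicity and jumps of the index along the pencil\<close>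

lemma inertia_pencil: "nidx t + pidx t + mult t = d"
  using inertia[OF hermitian_pencil[OF H]] .

lemma nidx_mono: "s \<le> t \<Longrightarrow> nidx s \<le> nidx t"
  by (rule neg_index_mono)
     (auto simp: qform_pencil simp flip: mass_def intro!: mult_right_mono mass_nonneg)

text \<open>Passing from s to t lowers the form by t - s times the mass. A negative subspace at s
  thus stays negative after adjoining the kernel at s, on whose nonzero vectors the mass is
  positive.\<close>

lemma nidx_jump:
  assumes "s < t"
  shows "nidx s + mult s \<le> nidx t"
proof -
  let ?P = "\<lambda>t. pencil H w (of_real t)"
  have herm: "hermitian (?P s)" using H by (rule hermitian_pencil)
  obtain S where S: "neg_subspace d (?P s) S" "seqs.dim S = nidx s"
    using neg_index_witness .
  then have sub: "seqs.subspace S" "S \<subseteq> coords d" by (auto simp: neg_subspace_def)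
  let ?K = "kernel d (?P s)"
  have neg: "qform d (?P s) x < 0" if "x \<in> S" "x \<noteq> 0" for x
    using S that by (simp add: neg_subspace_def)
  have "S \<inter> ?K \<subseteq> {0}"
  proof
    fix x assume "x \<in> S \<inter> ?K"
    then show "x \<in> {0}" using neg[of x] sesq_kernel[of x d "?P s" x] by fastforce
  qed
  then have dim: "seqs.dim (seqs.span (S \<union> ?K)) = nidx s + mult s"
    using dim_span_Un_direct[OF sub subspace_kernel kernel_subset_coords] S(2) by simp
  have "neg_subspace d (?P t) (seqs.span (S \<union> ?K))"
    unfolding neg_subspace_def
  proof (intro conjI ballI impI)
    show "seqs.span (S \<union> ?K) \<subseteq> coords d"
      using sub(2) kernel_subset_coords by (intro seqs.span_minimal subspace_coords) blast
    fix x assume "x \<in> seqs.span (S \<union> ?K)" and "x \<noteq> 0"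
    then obtain y k where x: "x = y + k" "y \<in> S" "k \<in> ?K"
      unfolding span_Un_subspaces[OF sub(1) subspace_kernel] by blast
    have "qform d (?P t) x = qform d (?P s) x - (t - s) * mass x"
      by (simp add: qform_pencil mass_def algebra_simps)
    also have "qform d (?P s) x = qform d (?P s) y"
      unfolding x(1) using herm x(3) by (rule qform_add_kernel)
    also have "\<dots> - (t - s) * mass x < 0"
    proof (cases "y = 0")
      case True
      then have "0 < mass x"
        using \<open>x \<noteq> 0\<close> x mass_kernel_pos by auto
      then show ?thesis using True assms by simp
    next
      case False
      have "0 \<le> (t - s) * mass x" using assms mass_nonneg by simp
      then show ?thesis using neg[OF x(2) False] by linarith
    qed
    finally show "qform d (?P t) x < 0" .
  qed simp
  then show ?thesis using neg_index_ge dim by metis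
qed

text \<open>The jumps accumulate: the largest point of F is split off and the others lie below
  it.\<close>

lemma sum_mult_le: "finite F \<Longrightarrow> (\<And>s. s \<in> F \<Longrightarrow> s < t) \<Longrightarrow> (\<Sum>s\<in>F. mult s) \<le> nidx t"
proof (induction F arbitrary: t rule: finite_linorder_max_induct)
  case (insert b A)
  then have "(\<Sum>s\<in>A. mult s) \<le> nidx b" by blast
  then show ?case
    using insert(1,2) insert.prems[of b] nidx_jump[of b t] by (subst sum.insert) auto
qed simp

text \<open>Each point of nonzero multiplicity raises the index by at least one, while the index
  never exceeds d.\<close>

lemma finite_eigenvalues: "finite {t. mult t \<noteq> 0}"
proof (rule ccontr)
  assume "infinite {t. mult t \<noteq> 0}"
  then obtain F where F: "F \<subseteq> {t. mult t \<noteq> 0}" "finite F" "card F = Suc d"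
    using infinite_arbitrarily_large by blast
  have "Suc d = (\<Sum>s\<in>F. 1)" using F(3) by simp
  also have "\<dots> \<le> (\<Sum>s\<in>F. mult s)" using F(1) by (intro sum_mono) (auto simp: Suc_le_eq)
  also have "\<dots> \<le> nidx (Max F + 1)"
    using F(2) by (intro sum_mult_le) (auto intro: le_less_trans[OF Max_ge])
  also have "\<dots> \<le> d" using inertia_pencil[of "Max F + 1"] by linarith
  finally show False by simp
qed

section \<open>The counting function of the eigenvalues\<close>

definition eig_count :: "real \<Rightarrow> nat" where
  "eig_count t = (\<Sum>s | mult s \<noteq> 0 \<and> s < t. mult s)"

lemma eig_count_alt: "eig_count t = (\<Sum>s | mult s \<noteq> 0. if s < t then mult s else 0)"
  using sum.inter_filter[OF finite_eigenvalues, of mult "\<lambda>s. s < t"]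
  by (simp add: eig_count_def)

text \<open>Counting strictly below t makes the function left-continuous, so the jump at
  \<open>t0\<close> shows only on the right.\<close>

lemma eventually_eig_count:
  "\<forall>\<^sub>F t in at t0. eig_count t = eig_count t0 + (if t0 < t then mult t0 else 0)"
proof -
  have "\<forall>\<^sub>F t in at t0. \<forall>s\<in>{s. mult s \<noteq> 0}. s \<noteq> t0 \<longrightarrow> (s < t \<longleftrightarrow> s < t0)"
  proof (intro eventually_ball_finite finite_eigenvalues ballI)
    fix s
    show "\<forall>\<^sub>F t in at t0. s \<noteq> t0 \<longrightarrow> (s < t \<longleftrightarrow> s < t0)"
    proof (cases s t0 rule: linorder_cases)
      case less
      then show ?thesis
        using order_tendstoD(1)[OF tendsto_ident_at[of t0 UNIV], of s] by (auto elim: eventually_mono)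
    next
      case greater
      then show ?thesis
        using order_tendstoD(2)[OF tendsto_ident_at[of t0 UNIV], of s] by (auto elim: eventually_mono)
    qed simp
  qed
  then show ?thesis
  proof eventually_elim
    case (elim t)
    have "eig_count t = (\<Sum>s | mult s \<noteq> 0.
        (if s < t0 then mult s else 0) + (if s = t0 then if t0 < t then mult t0 else 0 else 0))"
      unfolding eig_count_alt using elim by (intro sum.cong) auto
    also have "\<dots> = eig_count t0 + (if t0 < t then mult t0 else 0)"
      using finite_eigenvalues by (auto simp: sum.distrib eig_count_alt)
    finally show ?case .
  qed
qed

lemma pencil_tendsto: "((\<lambda>t. pencil H w (of_real t) i j) \<longlongrightarrow> pencil H w (of_real t0) i j) (at t0)"
  unfolding pencil_def by (auto intro!: tendsto_eq_intros)

text \<open>Near \<open>t0\<close> neither index falls below its value at \<open>t0\<close>. On the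
  left, monotonicity then fixes \<open>nidx\<close>; on the right, \<open>nidx_jump\<close> bounds
  it from below, and the bound for \<open>pidx\<close> with the inertia identity bounds it by the
  same number from above.\<close>

lemma eventually_nidx:
  "\<forall>\<^sub>F t in at t0. nidx t = nidx t0 + (if t0 < t then mult t0 else 0)"
proof -
  have "\<forall>\<^sub>F t in at t0. nidx t0 \<le> nidx t"
    by (rule neg_index_lower_semicontinuous) (rule hermitian_pencil[OF H] pencil_tendsto)+
  moreover have "\<forall>\<^sub>F t in at t0. pidx t0 \<le> pidx t"
    by (rule neg_index_lower_semicontinuous)
       (auto intro!: hermitian_uminus hermitian_pencil[OF H] tendsto_minus pencil_tendsto)
  moreover have "\<forall>\<^sub>F t in at t0. t \<noteq> t0"
    by (simp add: eventually_at_filter)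
  ultimately show ?thesis
  proof eventually_elim
    case (elim t)
    show ?case
    proof (cases "t0 < t")
      case True
      then show ?thesis
        using nidx_jump[OF True] inertia_pencil[of t] inertia_pencil[of t0] elim by simp
    next
      case False
      then show ?thesis using nidx_mono[of t t0] elim by simp
    qed
  qed
qed

text \<open>Equal jumps make the difference locally constant on the connected real line; integers
  replace the truncated subtraction of naturals.\<close>

lemma nidx_diff_const: "int (nidx s) - int (eig_count s) = int (nidx t) - int (eig_count t)"
proof (rule connected_local_const[of UNIV _ _ "\<lambda>t. int (nidx t) - int (eig_count t)"])
  show "\<forall>a\<in>UNIV. \<forall>\<^sub>F b in at a. int (nidx a) - int (eig_count a) = int (nidx b) - int (eig_count b)"
  proof
    fix a :: real
    show "\<forall>\<^sub>F b in at a. int (nidx a) - int (eig_count a) = int (nidx b) - int (eig_count b)"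
      using eventually_nidx[of a] eventually_eig_count[of a] by eventually_elim simp
  qed
qed auto

text \<open>As \<open>w 0 = 0\<close>, the entries (0,0) and (0,1) of the pencil do not depend on t,
  so \<open>neg_index_hyperbolic\<close> applies at every t.\<close>

lemma nidx_ge_1: "Re (H 0 0) \<le> 0 \<Longrightarrow> 1 \<le> nidx t"
  using d H01 w0 by (intro neg_index_hyperbolic hermitian_pencil H) (auto simp: pencil_def)

lemma pidx_ge_1: "Re (H 0 0) \<ge> 0 \<Longrightarrow> 1 \<le> pidx t"
  using d H01 w0 by (intro neg_index_hyperbolic hermitian_uminus hermitian_pencil H) (auto simp: pencil_def)

text \<open>The isotropic or negative direction \<open>e\<^sub>0\<close>, where the weight vanishes, accounts for one
  negative square that is not an eigenvalue.\<close>

theorem nidx_eq_count: "nidx t = (if Re (H 0 0) \<le> 0 then 1 else 0) + eig_count t"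
proof -
  have "\<forall>\<^sub>F s in at_bot. d - 1 + (if Re (H 0 0) > 0 then 1 else 0) \<le> pidx s"
    using d by (intro pos_index_pencil_at_bot H w0 w_pos) auto
  moreover have "\<forall>\<^sub>F s in at_bot. \<forall>r\<in>{r. mult r \<noteq> 0}. s \<le> r"
    by (intro eventually_ball_finite finite_eigenvalues ballI eventually_le_at_bot)
  ultimately have "\<forall>\<^sub>F s in at_bot. nidx s = (if Re (H 0 0) \<le> 0 then 1 else 0) \<and> eig_count s = 0"
  proof eventually_elim
    case (elim s)
    have "{r. mult r \<noteq> 0 \<and> r < s} = {}"
    proof (rule equals0I)
      fix r assume "r \<in> {r. mult r \<noteq> 0 \<and> r < s}"
      moreover from this have "s \<le> r" using elim(2) by blast
      ultimately show False by simp
    qed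
    then have "eig_count s = 0" unfolding eig_count_def by (simp only: sum.empty)
    \<comment> \<open>The lower bounds for \<open>pidx\<close> and \<open>nidx\<close> add up to d,
      so the inertia identity leaves no room for more.\<close>
    moreover have "nidx s = (if Re (H 0 0) \<le> 0 then 1 else 0)"
      using elim(1) inertia_pencil[of s] nidx_ge_1[of s] d by (auto split: if_splits)
    ultimately show ?case by simp
  qed
  then obtain s where "nidx s = (if Re (H 0 0) \<le> 0 then 1 else 0)" "eig_count s = 0"
    using eventually_happens trivial_limit_at_bot_linorder by blast
  then show ?thesis using nidx_diff_const[of t s] by (simp split: if_splits)
qed

text \<open>Above all eigenvalues the index is d if \<open>Re (H 0 0) < 0\<close> and d - 1
  otherwise. The constant part to subtract is 1 for \<open>Re (H 0 0) \<le> 0\<close> and 0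
  otherwise, so both losses coincide exactly in the isotropic case.\<close>

theorem sum_mult: "(\<Sum>s | mult s \<noteq> 0. mult s) = (if Re (H 0 0) = 0 then d - 2 else d - 1)"
proof -
  \<comment> \<open>The behaviour at plus infinity is that at minus infinity for the pencil of -H
    with parameter -t.\<close>
  have "\<forall>\<^sub>F s in at_bot. d - 1 + (if Re ((- H) 0 0) > 0 then 1 else 0)
      \<le> neg_index d (- pencil (- H) w (of_real s))"
    using d by (intro pos_index_pencil_at_bot hermitian_uminus H w0 w_pos) auto
  moreover have "- pencil (- H) w (of_real s) = pencil H w (of_real (- s))" for s
    by (simp add: minus_pencil)
  ultimately have "\<forall>\<^sub>F s in at_bot. d - 1 + (if Re (H 0 0) < 0 then 1 else 0) \<le> nidx (- s)"
    by simp
  moreover have "\<forall>\<^sub>F s in at_bot. \<forall>r\<in>{r. mult r \<noteq> 0}. s < - r"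
    by (intro eventually_ball_finite finite_eigenvalues ballI eventually_gt_at_bot)
  ultimately have "\<forall>\<^sub>F s in at_bot. d - 1 + (if Re (H 0 0) < 0 then 1 else 0) \<le> nidx (- s)
      \<and> {r. mult r \<noteq> 0 \<and> r < - s} = {r. mult r \<noteq> 0}"
  proof eventually_elim
    case (elim s)
    have "r < - s" if "mult r \<noteq> 0" for r
    proof -
      have "s < - r" using elim(2) that by blast
      then show ?thesis by simp
    qed
    then show ?case using elim(1) by blast
  qed
  then obtain s where s: "d - 1 + (if Re (H 0 0) < 0 then 1 else 0) \<le> nidx (- s)"
    "{r. mult r \<noteq> 0 \<and> r < - s} = {r. mult r \<noteq> 0}"
    using eventually_happens trivial_limit_at_bot_linorder by blast
  then have "nidx (- s) = (if Re (H 0 0) \<le> 0 then 1 else 0) + (\<Sum>r | mult r \<noteq> 0. mult r)"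
    using nidx_eq_count[of "- s"] by (simp add: eig_count_def)
  then show ?thesis
    using s(1) inertia_pencil[of "- s"] pidx_ge_1[of "- s"] d by (auto split: if_splits)
qed

end

section \<open>The coordinate chart\<close>

definition minor :: "complex^4^2 \<Rightarrow> 4 \<Rightarrow> 4 \<Rightarrow> complex" where
  "minor M j k = M $ 1 $ j * M $ 2 $ k - M $ 1 $ k * M $ 2 $ j"

text \<open>Ratios of \<open>2 \<times> 2\<close> minors depend only on the class of a matrix, and they recover the
  coordinates of \<^const>\<open>bc24\<close>.\<close>

definition chart :: "complex^4^2 \<Rightarrow> real \<times> complex \<times> real" where
  "chart M = (Re (- minor M 1 4 / minor M 2 4), - minor M 1 2 / minor M 2 4,
     Re (minor M 2 3 / minor M 2 4))"

section \<open>Invariants of a class and injectivity of the coordinates\<close>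

lemma minor_mult: "minor (P ** M) j k = det P * minor M j k" for P :: "complex^2^2"
  by (simp add: minor_def matrix_matrix_mult_def sum_2 det_2 algebra_simps)

lemma chart_mult: "invertible P \<Longrightarrow> chart (P ** M) = chart M" for P :: "complex^2^2"
  by (simp add: chart_def minor_mult invertible_det_nz)

lemma minor_bc24_matrix: "minor (bc24_matrix a z b) 2 4 = - 1"
  by (simp add: minor_def bc24_matrix_def)

lemma chart_bc24_matrix: "chart (bc24_matrix a z b) = (a, z, b)"
  by (simp add: chart_def minor_def bc24_matrix_def)

lemma mem_bc_class_self: "M \<in> bc_class M"
proof -
  have "invertible (mat 1 :: complex^2^2)"
    unfolding invertible_def by (metis matrix_mul_lid)
  then show ?thesis unfolding bc_class_def by (force simp: matrix_mul_lid)
qed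

lemma bc_class_eqD:
  assumes "bc_class M = bc_class M'"
  obtains P where "invertible P" "M = P ** M'"
  using assms mem_bc_class_self[of M] by (auto simp: bc_class_def)

lemma bc24_inject: "bc24 a z b = bc24 a' z' b' \<longleftrightarrow> a = a' \<and> z = z' \<and> b = b'"
proof
  assume "bc24 a z b = bc24 a' z' b'"
  then obtain P :: "complex^2^2" where P: "invertible P" "bc24_matrix a z b = P ** bc24_matrix a' z' b'"
    unfolding bc24_def by (rule bc_class_eqD)
  have "chart (bc24_matrix a z b) = chart (bc24_matrix a' z' b')"
    unfolding P(2) using P(1) by (rule chart_mult)
  then show "a = a' \<and> z = z' \<and> b = b'" by (simp add: chart_bc24_matrix)
qed simp

section \<open>The quotient topology in coordinates\<close>

lemma bc24_in_bc_space: "bc24 a z b \<in> topspace bc_space"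
  using O24_subset by (auto simp: topspace_bc_space O24_def)

text \<open>Nonvanishing of the (2,4) minor and the value of \<open>chart\<close> are unchanged by
  left multiplication. The set of matrices is therefore saturated, and its openness descends to the
  quotient.\<close>

lemma openin_chart:
  assumes "open G"
  shows "openin rank2_classes (bc_class ` {M \<in> rank2_matrices. minor M 2 4 \<noteq> 0 \<and> chart M \<in> G})"
proof -
  let ?V = "{M \<in> rank2_matrices. minor M 2 4 \<noteq> 0 \<and> chart M \<in> G}"
  let ?W = "{M. minor M 2 4 \<noteq> 0}"
  have minor_cont: "continuous_on S (\<lambda>M. minor M j k)" for S j k
    unfolding minor_def by (intro continuous_intros)
  have "open ?W"
    using open_Collect_neq[OF minor_cont continuous_on_const] by simp
  moreover have "continuous_on ?W chart"
    unfolding chart_def by (intro continuous_intros minor_cont) auto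
  ultimately have "open (?W \<inter> chart -` G)"
    using assms by (metis continuous_on_open_vimage Int_commute)
  then have "openin (top_of_set rank2_matrices) (rank2_matrices \<inter> (?W \<inter> chart -` G))"
    by (rule openin_open_Int)
  also have "rank2_matrices \<inter> (?W \<inter> chart -` G) = {M \<in> rank2_matrices. bc_class M \<in> bc_class ` ?V}"
  proof (intro subset_antisym subsetI)
    fix M assume "M \<in> {M \<in> rank2_matrices. bc_class M \<in> bc_class ` ?V}"
    then obtain M' where M: "M \<in> rank2_matrices" "M' \<in> ?V" "bc_class M = bc_class M'" by blast
    then obtain P :: "complex^2^2" where P: "invertible P" "M = P ** M'"
      by (rule_tac bc_class_eqD)
    have "minor M 2 4 \<noteq> 0" "chart M = chart M'"
      using P M(2) by (auto simp: minor_mult chart_mult invertible_det_nz)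
    then show "M \<in> rank2_matrices \<inter> (?W \<inter> chart -` G)" using M by auto
  qed auto
  finally show ?thesis
    unfolding openin_rank2_classes by blast
qed

text \<open>This transfers a statement that holds near a point of the parameter space to the
  topology of classes; every later limit passes through it.\<close>

lemma eventually_atin_within_bc24:
  assumes "\<forall>\<^sub>F (a, z, b) in nhds (a0, z0, b0). bc24 a z b \<in> S \<longrightarrow> P (bc24 a z b)" and S: "S \<subseteq> O24"
  shows "eventually P (atin_within bc_space (bc24 a0 z0 b0) S)"
proof -
  obtain G where G: "open G" "(a0, z0, b0) \<in> G"
    "\<forall>(a, z, b)\<in>G. bc24 a z b \<in> S \<longrightarrow> P (bc24 a z b)"
    using assms(1) unfolding eventually_nhds by (elim exE conjE)
  let ?U = "bc_class ` {M \<in> rank2_matrices. minor M 2 4 \<noteq> 0 \<and> chart M \<in> G}"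
  have "openin bc_space (self_adjoint_bcs \<inter> ?U)"
    unfolding bc_space_def using openin_chart[OF G(1)] by (rule openin_subtopology_Int2)
  moreover have "bc24 a0 z0 b0 \<in> self_adjoint_bcs \<inter> ?U"
    using bc24_in_bc_space[of a0 z0 b0] G(2)
    by (auto simp: topspace_bc_space bc24_def bc24_matrix_rank2 minor_bc24_matrix chart_bc24_matrix)
  moreover have "P A" if A: "A \<in> self_adjoint_bcs \<inter> ?U" "A \<in> S" for A
  proof -
    obtain a z b where abc: "A = bc24 a z b" using A(2) S by (auto simp: O24_def)
    obtain M where M: "A = bc_class M" "chart M \<in> G" using A(1) by blast
    have "bc_class (bc24_matrix a z b) = bc_class M" using abc M(1) by (simp add: bc24_def)
    then obtain Q :: "complex^2^2" where Q: "invertible Q" "bc24_matrix a z b = Q ** M"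
      by (rule bc_class_eqD)
    then have "chart M = (a, z, b)"
      using chart_mult[OF Q(1), of M] chart_bc24_matrix[of a z b] by simp
    then show "P A" using G(3) M(2) A(2) abc by auto
  qed
  ultimately show ?thesis
    unfolding eventually_atin_within by (intro disjI2 exI[of _ "self_adjoint_bcs \<inter> ?U"]) simp
qed

text \<open>The converse direction along the \<open>a\<close>-axis, used to see that points of the
  layer are approached from the plus side.\<close>

lemma continuous_map_bc24: "continuous_map euclideanreal bc_space (\<lambda>a. bc24 a z b)"
proof -
  have "continuous_on UNIV (\<lambda>a. bc24_matrix a z b)"
  proof -
    have "continuous_on UNIV (\<lambda>a. bc24_matrix a z b $ i $ j)" for i j
    proof -
      have "\<forall>i j. continuous_on UNIV (\<lambda>a. bc24_matrix a z b $ i $ j)"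
        unfolding bc24_matrix_def forall_2 forall_4 by (simp add: continuous_intros)
      then show ?thesis by blast
    qed
    then show ?thesis
      by (subst vec_lambda_eta[symmetric], intro continuous_on_vec_lambda)
         (subst vec_lambda_eta[symmetric], intro continuous_on_vec_lambda)
  qed
  then have "continuous_map euclideanreal (top_of_set rank2_matrices) (\<lambda>a. bc24_matrix a z b)"
    by (auto simp: continuous_map_in_subtopology bc24_matrix_rank2)
  then have "continuous_map euclideanreal rank2_classes (bc_class \<circ> (\<lambda>a. bc24_matrix a z b))"
    using quotient_imp_continuous_map[OF quotient_map_bc_class] by (rule continuous_map_compose)
  then show ?thesis
    using bc24_in_bc_space unfolding bc_space_def topspace_bc_space[unfolded bc_space_def]
    by (auto simp: continuous_map_in_subtopology bc24_def o_def)
qed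

text \<open>Limits along this filter can contradict continuity only because it is proper.\<close>

lemma B24_plus_nontrivial: "atin_within bc_space (bc24 (- f0) z b) (B24_plus f0) \<noteq> bot"
proof
  assume "atin_within bc_space (bc24 (- f0) z b) (B24_plus f0) = bot"
  then have "eventually (\<lambda>_. False) (atin_within bc_space (bc24 (- f0) z b) (B24_plus f0))"
    by simp
  then obtain T where T: "openin bc_space T" "bc24 (- f0) z b \<in> T"
    "\<And>A. A \<in> T \<Longrightarrow> A \<in> B24_plus f0 \<Longrightarrow> A = bc24 (- f0) z b"
    using bc24_in_bc_space by (auto simp: eventually_atin_within)
  have "open {a. bc24 a z b \<in> T}"
    using openin_continuous_map_preimage[OF continuous_map_bc24[of z b] T(1)] by simp
  moreover have "- f0 \<in> {a. bc24 a z b \<in> T}"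
    using T(2) by simp
  ultimately obtain e where "0 < e" and e: "\<forall>a. dist a (- f0) < e \<longrightarrow> a \<in> {a. bc24 a z b \<in> T}"
    unfolding open_dist by blast
  then have "bc24 (- f0 + e / 2) z b \<in> T" using e by (simp add: dist_real_def)
  moreover have "bc24 (- f0 + e / 2) z b \<in> B24_plus f0"
    using \<open>0 < e\<close> by (force simp: B24_plus_def)
  ultimately show False
    using T(3)[of "bc24 (- f0 + e / 2) z b"] \<open>0 < e\<close> by (simp add: bc24_inject)
qed

section \<open>Membership in the layers\<close>

lemma bc24_in_B24 [simp]: "bc24 a z b \<in> B24 f0 \<longleftrightarrow> a = - f0"
  by (auto simp: B24_def bc24_inject)

lemma bc24_in_B24_plus [simp]: "bc24 a z b \<in> B24_plus f0 \<longleftrightarrow> a > - f0"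
  by (auto simp: B24_plus_def bc24_inject)

lemma bc24_in_B24_minus [simp]: "bc24 a z b \<in> B24_minus f0 \<longleftrightarrow> a < - f0"
  by (auto simp: B24_minus_def bc24_inject)

lemma bc24_in_O24 [simp]: "bc24 a z b \<in> O24"
  by (auto simp: O24_def)

lemma layers_subset_O24: "B24 f0 \<subseteq> O24" "B24_plus f0 \<subseteq> O24" "B24_minus f0 \<subseteq> O24"
  by (auto simp: O24_def B24_def B24_plus_def B24_minus_def)

section \<open>The Sturm-Liouville problem as a Hermitian pencil\<close>

text \<open>The entry at 0 vanishes exactly on the layer. The entry at N contains b in place of
  \<open>f N\<close>, because the second boundary condition replaces f_N (y_{N+1} - y_N) by -(z y_0
  + b y_N).\<close>

definition sl_diag :: "nat \<Rightarrow> (nat \<Rightarrow> real) \<Rightarrow> (nat \<Rightarrow> real) \<Rightarrow> real \<Rightarrow> real \<Rightarrow> nat \<Rightarrow> real" where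
  "sl_diag N f q a b i =
     (if i = 0 then a + f 0 else if i < N then f i + f (i - 1) + q i else f (N - 1) + q N + b)"

text \<open>The first boundary condition becomes the equation in row \<open>0\<close>; the second one is used to
  eliminate \<open>y\<^bsub>N+1\<^esub>\<close> from the difference equation at \<open>N\<close>, and \<open>y\<^sub>0\<close> is kept as an unknown.  The weight
  then vanishes at index \<open>0\<close>, but the matrix is Hermitian and depends continuously on the boundary
  condition even across \<open>a = - f 0\<close>.\<close>

definition sl_matrix ::
  "nat \<Rightarrow> (nat \<Rightarrow> real) \<Rightarrow> (nat \<Rightarrow> real) \<Rightarrow> real \<Rightarrow> complex \<Rightarrow> real \<Rightarrow> nat \<Rightarrow> nat \<Rightarrow> complex" where
  "sl_matrix N f q a z b = (\<lambda>i j.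
     (if i = j then of_real (sl_diag N f q a b i) else 0)
     - (if j = Suc i then of_real (f i) else 0) - (if i = Suc j then of_real (f j) else 0)
     + (if i = 0 \<and> j = N then cnj z else 0) + (if i = N \<and> j = 0 then z else 0))"

definition sl_weight :: "(nat \<Rightarrow> real) \<Rightarrow> nat \<Rightarrow> real" where
  "sl_weight w i = (if i = 0 then 0 else w i)"

section \<open>The matrix, the boundary condition and the equation row by row\<close>

lemma hermitian_sl_matrix: "hermitian (sl_matrix N f q a z b)"
proof (rule hermitianI)
  fix i j
  show "cnj (sl_matrix N f q a z b i j) = sl_matrix N f q a z b j i"
    by (cases i j rule: linorder_cases) (simp_all add: sl_matrix_def)
qed

lemma mat_vec_sl_matrix:
  assumes "i \<le> N"
  shows "mat_vec (Suc N) (sl_matrix N f q a z b) x i =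
    of_real (sl_diag N f q a b i) * x i - (if i < N then of_real (f i) * x (Suc i) else 0)
    - (if 0 < i then of_real (f (i - 1)) * x (i - 1) else 0)
    + (if i = 0 then cnj z * x N else 0) + (if i = N then z * x 0 else 0)"
proof -
  \<comment> \<open>The condition \<open>i = Suc j\<close> becomes \<open>j = i - 1\<close> with a
    guard for \<open>i = 0\<close>, so that each summand is a single delta in j.\<close>
  have "mat_vec (Suc N) (sl_matrix N f q a z b) x i = (\<Sum>j<Suc N.
    (if j = i then of_real (sl_diag N f q a b i) * x i else 0)
    - (if j = Suc i then of_real (f i) * x (Suc i) else 0)
    - (if j = i - 1 then if 0 < i then of_real (f (i - 1)) * x (i - 1) else 0 else 0)
    + (if j = N then if i = 0 then cnj z * x N else 0 else 0)
    + (if j = 0 then if i = N then z * x 0 else 0 else 0))"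
    unfolding mat_vec_def sl_matrix_def
  proof (intro sum.cong refl)
    fix j
    show "((if i = j then complex_of_real (sl_diag N f q a b i) else 0)
     - (if j = Suc i then complex_of_real (f i) else 0) - (if i = Suc j then complex_of_real (f j) else 0)
     + (if i = 0 \<and> j = N then cnj z else 0) + (if i = N \<and> j = 0 then z else 0)) * x j =
    (if j = i then complex_of_real (sl_diag N f q a b i) * x i else 0)
    - (if j = Suc i then complex_of_real (f i) * x (Suc i) else 0)
    - (if j = i - 1 then if 0 < i then complex_of_real (f (i - 1)) * x (i - 1) else 0 else 0)
    + (if j = N then if i = 0 then cnj z * x N else 0 else 0)
    + (if j = 0 then if i = N then z * x 0 else 0 else 0)"
      by (cases i) (simp_all add: algebra_simps)
  qed
  also have "\<dots> = of_real (sl_diag N f q a b i) * x i - (if i < N then of_real (f i) * x (Suc i) else 0)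
    - (if 0 < i then of_real (f (i - 1)) * x (i - 1) else 0)
    + (if i = 0 then cnj z * x N else 0) + (if i = N then z * x 0 else 0)"
    unfolding sum.distrib sum_subtractf using assms by (auto simp: sum.delta simp del: sum.lessThan_Suc)
  finally show ?thesis .
qed

lemma vector_2_eq_0_iff: "(vector [x, y] :: complex^2) = 0 \<longleftrightarrow> x = 0 \<and> y = 0"
  by (simp add: vec_eq_iff forall_2)

lemma satisfies_bc_bc24:
  "satisfies_bc N f (bc24 a z b) y \<longleftrightarrow>
     of_real (a + f 0) * y 0 - of_real (f 0) * y 1 + cnj z * y N = 0 \<and>
     z * y 0 + of_real b * y N + of_real (f N) * (y (Suc N) - y N) = 0"
proof -
  let ?M = "bc24_matrix a z b"
  define res where "res M = left_block M *v vector [y 0, of_real (f 0) * fwd_diff y 0] +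
     right_block M *v vector [y N, of_real (f N) * fwd_diff y N]" for M
  \<comment> \<open>The residual is equivariant under left multiplication, so the condition for all
    representatives reduces to one of them.\<close>
  have "res (P ** M) = P *v res M" for P M
    by (simp add: res_def left_block_def right_block_def vec_eq_iff forall_2 matrix_vector_mult_def
        matrix_matrix_mult_def sum_2 algebra_simps)
  moreover have "?M \<in> bc24 a z b"
    by (simp add: bc24_def mem_bc_class_self)
  ultimately have "satisfies_bc N f (bc24 a z b) y \<longleftrightarrow> res ?M = 0"
    unfolding satisfies_bc_def res_def[symmetric] by (auto simp: bc24_def bc_class_def)
  also have "res ?M = vector [of_real (a + f 0) * y 0 - of_real (f 0) * y 1 + cnj z * y N,
      z * y 0 + of_real b * y N + of_real (f N) * (y (Suc N) - y N)]"
    by (simp add: res_def left_block_def right_block_def bc24_matrix_def vec_eq_iff forall_2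
        matrix_vector_mult_def sum_2 fwd_diff_def algebra_simps)
  finally show ?thesis by (simp only: vector_2_eq_0_iff)
qed

lemma satisfies_equation_iff:
  "satisfies_equation N f q w l y \<longleftrightarrow> (\<forall>n\<in>{1..N}.
     of_real (f n + f (n - 1) + q n) * y n - of_real (f n) * y (Suc n) - of_real (f (n - 1)) * y (n - 1)
       - l * of_real (w n) * y n = 0)"
  unfolding satisfies_equation_def
proof (intro ball_cong refl)
  fix n assume "n \<in> {1..N}"
  then obtain m where m: "n = Suc m" by (cases n) auto
  show "(- bwd_diff (\<lambda>k. of_real (f k) * fwd_diff y k) n + of_real (q n) * y n = l * of_real (w n) * y n)
    = (of_real (f n + f (n - 1) + q n) * y n - of_real (f n) * y (Suc n) - of_real (f (n - 1)) * y (n - 1)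
       - l * of_real (w n) * y n = 0)"
    unfolding m bwd_diff_def fwd_diff_def by (auto simp: algebra_simps)
qed

section \<open>Eigenspaces as kernels of the pencil\<close>

locale sl_problem =
  fixes N :: nat and f q w :: "nat \<Rightarrow> real"
  assumes N: "2 \<le> N" and f_nz: "\<And>n. n \<le> N \<Longrightarrow> f n \<noteq> 0"
    and w_pos: "\<And>n. 1 \<le> n \<Longrightarrow> n \<le> N \<Longrightarrow> 0 < w n"
begin

abbreviation sl_pencil :: "real \<Rightarrow> complex \<Rightarrow> real \<Rightarrow> complex \<Rightarrow> nat \<Rightarrow> nat \<Rightarrow> complex" where
  "sl_pencil a z b \<equiv> pencil (sl_matrix N f q a z b) (sl_weight w)"

abbreviation sl_kernel :: "real \<Rightarrow> complex \<Rightarrow> real \<Rightarrow> complex \<Rightarrow> (nat \<Rightarrow> complex) set" where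
  "sl_kernel a z b l \<equiv> kernel (Suc N) (sl_pencil a z b l)"

abbreviation sl_mult :: "real \<Rightarrow> complex \<Rightarrow> real \<Rightarrow> real \<Rightarrow> nat" where
  "sl_mult a z b t \<equiv> seqs.dim (sl_kernel a z b (of_real t))"

abbreviation sl_index :: "real \<Rightarrow> complex \<Rightarrow> real \<Rightarrow> real \<Rightarrow> nat" where
  "sl_index a z b t \<equiv> neg_index (Suc N) (sl_pencil a z b (of_real t))"

abbreviation ev :: "nat \<Rightarrow> (complex^4^2) set \<Rightarrow> real" where
  "ev \<equiv> nth_eigenvalue N f q w"

lemma bordered: "bordered_pencil (Suc N) (sl_matrix N f q a z b) (sl_weight w)"
proof
  show "sl_matrix N f q a z b 0 1 \<noteq> 0"
    using N f_nz[of 0] by (simp add: sl_matrix_def)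
qed (use N w_pos in \<open>auto simp: hermitian_sl_matrix sl_weight_def\<close>)

text \<open>Restores the eliminated value y_{N+1} by solving the second boundary condition for
  it.\<close>

definition extend :: "complex \<Rightarrow> real \<Rightarrow> (nat \<Rightarrow> complex) \<Rightarrow> nat \<Rightarrow> complex" where
  "extend z b x n = (if n = Suc N then x N - (z * x 0 + of_real b * x N) / of_real (f N) else x n)"

lemma linear_extend: "Vector_Spaces.linear scale_seq scale_seq (extend z b)"
  unfolding Vector_Spaces.linear_iff
proof (intro conjI vector_space_scale_seq allI)
  show "extend z b (x + y) = extend z b x + extend z b y" for x y
  proof (rule ext)
    show "extend z b (x + y) n = (extend z b x + extend z b y) n" for n
      by (cases "n = Suc N") (simp_all add: extend_def divide_inverse algebra_simps)
  qed
  show "extend z b (scale_seq c x) = scale_seq c (extend z b x)" for c x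
  proof (rule ext)
    show "extend z b (scale_seq c x) n = scale_seq c (extend z b x) n" for n
      by (cases "n = Suc N")
         (simp_all add: extend_def scale_seq_apply divide_inverse algebra_simps)
  qed
qed

text \<open>Row 0 of the pencil is the first boundary condition and rows 1 to N are the difference
  equation for the extended sequence, which satisfies the second boundary condition by
  construction.\<close>

lemma sl_kernel_iff:
  "x \<in> sl_kernel a z b l \<longleftrightarrow> x \<in> coords (Suc N) \<and> extend z b x \<in> eigenspace N f q w (bc24 a z b) l"
proof (cases "x \<in> coords (Suc N)")
  case True
  let ?y = "extend z b x"
  have fN: "complex_of_real (f N) \<noteq> 0" using f_nz[of N] by simp
  have y: "?y n = x n" if "n \<le> N" for n
    using that by (simp add: extend_def)
  have yN: "of_real (f N) * ?y (Suc N) = of_real (f N) * x N - (z * x 0 + of_real b * x N)"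
    using fN by (simp add: extend_def field_simps)
  have out: "?y n = 0" if "n > N + 1" for n
    using that True by (simp add: extend_def coords_def)
  have bc2: "z * ?y 0 + of_real b * ?y N + of_real (f N) * (?y (Suc N) - ?y N) = 0"
    using yN by (simp add: y right_diff_distrib)
  have row0: "mat_vec (Suc N) (sl_pencil a z b l) x 0
      = of_real (a + f 0) * ?y 0 - of_real (f 0) * ?y 1 + cnj z * ?y N"
    using N by (simp add: mat_vec_pencil mat_vec_sl_matrix sl_weight_def sl_diag_def y)
  have row: "mat_vec (Suc N) (sl_pencil a z b l) x n
      = of_real (f n + f (n - 1) + q n) * ?y n - of_real (f n) * ?y (Suc n)
        - of_real (f (n - 1)) * ?y (n - 1) - l * of_real (w n) * ?y n" if n: "n \<in> {1..N}" for n
  proof (cases "n = N")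
    case True
    then show ?thesis
      using N unfolding True yN
      by (simp add: mat_vec_pencil mat_vec_sl_matrix sl_weight_def sl_diag_def y algebra_simps)
  next
    case False
    then show ?thesis
      using n N y[OF order_trans[OF diff_le_self[of n 1]]]
      by (simp add: mat_vec_pencil mat_vec_sl_matrix sl_weight_def sl_diag_def y)
  qed
  have lessThan: "{..<Suc N} = insert 0 {1..N}" by auto
  have all: "(\<forall>i<Suc N. P i) \<longleftrightarrow> P 0 \<and> (\<forall>n\<in>{1..N}. P n)" for P
  proof -
    have "(\<forall>i<Suc N. P i) \<longleftrightarrow> (\<forall>i\<in>{..<Suc N}. P i)" by (simp only: Ball_def lessThan_iff)
    then show ?thesis unfolding lessThan by simp
  qed
  have "x \<in> sl_kernel a z b l \<longleftrightarrow> (\<forall>i<Suc N. mat_vec (Suc N) (sl_pencil a z b l) x i = 0)"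
    using True by (simp add: kernel_def)
  also have "\<dots> \<longleftrightarrow> of_real (a + f 0) * ?y 0 - of_real (f 0) * ?y 1 + cnj z * ?y N = 0 \<and>
      satisfies_equation N f q w l ?y"
    unfolding all satisfies_equation_iff row0 using row by simp
  also have "\<dots> \<longleftrightarrow> ?y \<in> eigenspace N f q w (bc24 a z b) l"
    unfolding eigenspace_def satisfies_bc_bc24 using out bc2 by auto
  finally show ?thesis using True by simp
qed (auto simp: kernel_def)

lemma eigenspace_eq_extend: "eigenspace N f q w (bc24 a z b) l = extend z b ` sl_kernel a z b l"
proof (intro subset_antisym subsetI)
  fix y assume y: "y \<in> eigenspace N f q w (bc24 a z b) l"
  \<comment> \<open>Truncation inverts \<open>extend\<close>: the second boundary condition
    determines the dropped value.\<close>
  define x where "x n = (if n \<le> N then y n else 0)" for n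
  have "z * y 0 + of_real b * y N + of_real (f N) * (y (Suc N) - y N) = 0"
    using y by (simp add: eigenspace_def satisfies_bc_bc24)
  moreover have "complex_of_real (f N) \<noteq> 0" using f_nz[of N] by simp
  ultimately have "y (Suc N) = y N - (z * y 0 + of_real b * y N) / of_real (f N)"
    by (simp add: field_simps)
  moreover have "y n = 0" if "n > Suc N" for n
    using y that by (simp add: eigenspace_def)
  ultimately have "y n = extend z b x n" for n
    by (cases "n \<le> N"; cases "n = Suc N") (auto simp: extend_def x_def)
  then have ext: "y = extend z b x" by blast
  moreover have "x \<in> sl_kernel a z b l"
    unfolding sl_kernel_iff using y ext by (auto simp: x_def coords_def)
  ultimately show "y \<in> extend z b ` sl_kernel a z b l" by blast
next
  fix y assume "y \<in> extend z b ` sl_kernel a z b l"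
  then show "y \<in> eigenspace N f q w (bc24 a z b) l"
    by (auto simp only: sl_kernel_iff)
qed

lemma inj_on_extend: "inj_on (extend z b) (coords (Suc N))"
proof (rule inj_onI)
  fix x y assume "x \<in> coords (Suc N)" "y \<in> coords (Suc N)" and eq: "extend z b x = extend z b y"
  then have "\<forall>n\<ge>Suc N. x n = y n" by (simp add: coords_def)
  moreover have "x n = y n" if "n < Suc N" for n
    using fun_cong[OF eq, of n] that unfolding extend_def by simp
  ultimately show "x = y" by (metis ext not_le)
qed

lemma eig_mult_bc24: "eig_mult N f q w (bc24 a z b) l = seqs.dim (sl_kernel a z b l)"
  unfolding eig_mult_def eigenspace_eq_extend
  by (intro dim_linear_image_inj_on linear_extend subspace_kernel
      inj_on_subset[OF inj_on_extend kernel_subset_coords])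

text \<open>\<open>eigenvalue_real\<close> confines the complex spectrum to the real axis, where the
  multiplicities of the pencil describe it.\<close>

lemma spectrum_bc24: "spectrum N f q w (bc24 a z b) = of_real ` {t. sl_mult a z b t \<noteq> 0}"
proof -
  interpret bordered_pencil "Suc N" "sl_matrix N f q a z b" "sl_weight w"
    by (rule bordered)
  have nz: "extend z b x \<noteq> 0 \<longleftrightarrow> x \<noteq> 0" if "x \<in> coords (Suc N)" for x
  proof -
    have "0 \<in> coords (Suc N)" using subspace_coords by (rule seqs.subspace_0)
    moreover have "extend z b 0 = 0" by (auto simp: extend_def fun_eq_iff)
    ultimately show ?thesis using inj_onD[OF inj_on_extend, of z b x 0] that by metis
  qed
  have mult_iff: "seqs.dim (sl_kernel a z b l) \<noteq> 0 \<longleftrightarrow> (\<exists>x\<in>sl_kernel a z b l. x \<noteq> 0)" for l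
    using dim_pos_iff[OF kernel_subset_coords] by (metis neq0_conv)
  have "l \<in> spectrum N f q w (bc24 a z b) \<longleftrightarrow> (\<exists>x\<in>sl_kernel a z b l. x \<noteq> 0)" for l
    unfolding spectrum_def eigenspace_eq_extend using nz kernel_subset_coords by blast
  then have "l \<in> spectrum N f q w (bc24 a z b) \<longleftrightarrow> l \<in> \<real> \<and> seqs.dim (sl_kernel a z b l) \<noteq> 0" for l
    using eigenvalue_real mult_iff by metis
  then show ?thesis by (auto simp: Reals_def)
qed

section \<open>Number of eigenvalues on and off the layer\<close>

definition count :: "real \<Rightarrow> nat" where
  "count a = (if a = - f 0 then N - 1 else N)"

text \<open>The value of the index below all eigenvalues.\<close>

definition shift :: "real \<Rightarrow> nat" where
  "shift a = (if a \<le> - f 0 then 1 else 0)"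

lemma sl_matrix_00: "Re (sl_matrix N f q a z b 0 0) = a + f 0"
  using N by (simp add: sl_matrix_def sl_diag_def)

lemma sum_sl_mult: "(\<Sum>s | sl_mult a z b s \<noteq> 0. sl_mult a z b s) = count a"
proof -
  interpret bordered_pencil "Suc N" "sl_matrix N f q a z b" "sl_weight w"
    by (rule bordered)
  have "a + f 0 = 0 \<longleftrightarrow> a = - f 0" by linarith
  then show ?thesis
    using sum_mult N unfolding sl_matrix_00 count_def by simp
qed

lemma finite_sl_mult: "finite {t. sl_mult a z b t \<noteq> 0}"
proof -
  interpret bordered_pencil "Suc N" "sl_matrix N f q a z b" "sl_weight w"
    by (rule bordered)
  show ?thesis by (rule finite_eigenvalues)
qed

lemma sl_index_eq:
  "sl_index a z b t = shift a + (\<Sum>s | sl_mult a z b s \<noteq> 0 \<and> s < t. sl_mult a z b s)"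
proof -
  interpret bordered_pencil "Suc N" "sl_matrix N f q a z b" "sl_weight w"
    by (rule bordered)
  have "a + f 0 \<le> 0 \<longleftrightarrow> a \<le> - f 0" by linarith
  then show ?thesis
    using nidx_eq_count[of t] unfolding sl_matrix_00 eig_count_def shift_def by simp
qed

lemma has_exactly_eigenvalues_bc24: "has_exactly_eigenvalues N f q w (bc24 a z b) (count a)"
  unfolding has_exactly_eigenvalues_def spectrum_bc24
proof (intro conjI)
  show "finite (complex_of_real ` {t. sl_mult a z b t \<noteq> 0})"
    using finite_sl_mult by (rule finite_imageI)
  show "complex_of_real ` {t. sl_mult a z b t \<noteq> 0} \<subseteq> \<real>"
    by auto
  have "(\<Sum>l\<in>complex_of_real ` {t. sl_mult a z b t \<noteq> 0}. eig_mult N f q w (bc24 a z b) l)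
      = (\<Sum>t | sl_mult a z b t \<noteq> 0. sl_mult a z b t)"
    unfolding eig_mult_bc24 by (subst sum.reindex) (auto simp: inj_on_def)
  then show "(\<Sum>l\<in>complex_of_real ` {t. sl_mult a z b t \<noteq> 0}. eig_mult N f q w (bc24 a z b) l) = count a"
    using sum_sl_mult by simp
qed

end

text \<open>The entries below t form a prefix of a sorted list. This turns bounds on the n-th
  eigenvalue into counting.\<close>

lemma sorted_nth_less_iff:
  fixes xs :: "'a::linorder list"
  shows "sorted xs \<Longrightarrow> n < length xs \<Longrightarrow> xs ! n < t \<longleftrightarrow> n < length (filter (\<lambda>x. x < t) xs)"
proof (induction xs arbitrary: n)
  case (Cons x xs)
  show ?case
  proof (cases "x < t")
    case True
    then show ?thesis using Cons by (cases n) auto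
  next
    case False
    have "\<not> y < t" if "y \<in> set (x # xs)" for y
      using False Cons.prems(1) that by auto
    then have "filter (\<lambda>x. x < t) (x # xs) = []"
      by (simp add: filter_empty_conv del: filter.simps)
    moreover have "\<not> (x # xs) ! n < t"
      using Cons.prems(2) \<open>\<And>y. y \<in> set (x # xs) \<Longrightarrow> \<not> y < t\<close> nth_mem by blast
    ultimately show ?thesis by (simp del: filter.simps)
  qed
qed simp

lemma sorted_concat_replicate:
  fixes m :: "'a::linorder \<Rightarrow> nat"
  shows "sorted xs \<Longrightarrow> sorted (concat (map (\<lambda>x. replicate (m x) x) xs))"
  by (induction xs) (auto simp: sorted_append)

lemma length_filter_concat_replicate:
  "length (filter P (concat (map (\<lambda>x. replicate (m x) x) xs))) = sum_list (map m (filter P xs))"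
  by (induction xs) auto

lemma sum_list_sorted_list_of_set:
  fixes m :: "'a::linorder \<Rightarrow> nat"
  assumes "finite X"
  shows "sum_list (map m (filter P (sorted_list_of_set X))) = (\<Sum>x | x \<in> X \<and> P x. m x)"
  using assms by (subst sum_list_distinct_conv_sum_set) auto

section \<open>The n-th eigenvalue in terms of the index\<close>

context sl_problem begin

lemma eigenvalue_list_bc24:
  "eigenvalue_list N f q w (bc24 a z b) =
     concat (map (\<lambda>t. replicate (sl_mult a z b t) t) (sorted_list_of_set {t. sl_mult a z b t \<noteq> 0}))"
proof -
  have "{t. complex_of_real t \<in> spectrum N f q w (bc24 a z b)} = {t. sl_mult a z b t \<noteq> 0}"
    unfolding spectrum_bc24 by auto
  then show ?thesis
    unfolding eigenvalue_list_def eig_mult_bc24 by simp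
qed

lemma length_eigenvalue_list: "length (eigenvalue_list N f q w (bc24 a z b)) = count a"
  using length_filter_concat_replicate[of "\<lambda>_. True" "sl_mult a z b"]
    sum_list_sorted_list_of_set[OF finite_sl_mult, of "sl_mult a z b" "\<lambda>_. True" a z b]
    sum_sl_mult[of a z b]
  unfolding eigenvalue_list_bc24 by simp

lemma nth_eigenvalue_defined_bc24: "nth_eigenvalue_defined N f q w n (bc24 a z b) \<longleftrightarrow> n < count a"
  by (simp add: nth_eigenvalue_defined_def length_eigenvalue_list)

text \<open>The n-th eigenvalue is below t when more than n eigenvalues are, counted with
  multiplicity, and the index is that count plus \<open>shift a\<close>. All further statements
  about eigenvalues rest on this translation.\<close>

lemma ev_less_iff:
  assumes "n < count a"
  shows "ev n (bc24 a z b) < t \<longleftrightarrow> n + shift a < sl_index a z b t"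
proof -
  let ?X = "{t. sl_mult a z b t \<noteq> 0}"
  have "ev n (bc24 a z b) < t \<longleftrightarrow> n < length (filter (\<lambda>x. x < t) (eigenvalue_list N f q w (bc24 a z b)))"
    unfolding nth_eigenvalue_def
  proof (rule sorted_nth_less_iff)
    show "sorted (eigenvalue_list N f q w (bc24 a z b))"
      unfolding eigenvalue_list_bc24 by (intro sorted_concat_replicate) simp
  qed (simp add: length_eigenvalue_list assms)
  also have "length (filter (\<lambda>x. x < t) (eigenvalue_list N f q w (bc24 a z b)))
      = (\<Sum>s | sl_mult a z b s \<noteq> 0 \<and> s < t. sl_mult a z b s)"
    unfolding eigenvalue_list_bc24 length_filter_concat_replicate sum_list_sorted_list_of_set[OF finite_sl_mult]
    by simp
  finally show ?thesis
    unfolding sl_index_eq by linarith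
qed

text \<open>Raising a and b adds the nonnegative form (a' - a)|x_0|^2 + (b' - b)|x_N|^2.\<close>

lemma sl_index_antimono:
  assumes "a \<le> a'" "b \<le> b'"
  shows "sl_index a' z b' t \<le> sl_index a z b t"
proof (rule neg_index_mono)
  fix x :: "nat \<Rightarrow> complex"
  have row: "mat_vec (Suc N) (sl_matrix N f q a' z b') x i = mat_vec (Suc N) (sl_matrix N f q a z b) x i
    + (if i = 0 then of_real (a' - a) * x 0 else 0) + (if i = N then of_real (b' - b) * x N else 0)"
    if "i \<le> N" for i
    using that N by (simp add: mat_vec_sl_matrix sl_diag_def algebra_simps)
  have "sesq (Suc N) (sl_matrix N f q a' z b') x x
      = (\<Sum>i<Suc N. cnj (x i) * mat_vec (Suc N) (sl_matrix N f q a z b) x i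
        + (if i = 0 then of_real (a' - a) * (cnj (x 0) * x 0) else 0)
        + (if i = N then of_real (b' - b) * (cnj (x N) * x N) else 0))"
    unfolding sesq_def by (intro sum.cong refl) (auto simp: row algebra_simps)
  also have "\<dots> = sesq (Suc N) (sl_matrix N f q a z b) x x
      + of_real (a' - a) * (cnj (x 0) * x 0) + of_real (b' - b) * (cnj (x N) * x N)"
    unfolding sum.distrib sesq_def by (simp del: sum.lessThan_Suc)
  finally have "qform (Suc N) (sl_matrix N f q a' z b') x = qform (Suc N) (sl_matrix N f q a z b) x
      + (a' - a) * Re (cnj (x 0) * x 0) + (b' - b) * Re (cnj (x N) * x N)"
    by (simp only: plus_complex.sel Re_of_real_mult)
  moreover have "0 \<le> (a' - a) * Re (cnj (x 0) * x 0)" "0 \<le> (b' - b) * Re (cnj (x N) * x N)"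
    using assms by (auto intro!: mult_nonneg_nonneg)
  ultimately show "qform (Suc N) (sl_pencil a z b (of_real t)) x
      \<le> qform (Suc N) (sl_pencil a' z b' (of_real t)) x"
    unfolding qform_pencil by linarith
qed

lemma ev_mono:
  assumes "a \<le> a'" "b \<le> b'" "n < count a" "n < count a'" "shift a = shift a'"
  shows "ev n (bc24 a z b) \<le> ev n (bc24 a' z b')"
proof (rule ccontr)
  assume "\<not> ?thesis"
  \<comment> \<open>The test point is the eigenvalue at the smaller parameters; it would have to lie
    strictly below itself.\<close>
  then have "n + shift a' < sl_index a' z b' (ev n (bc24 a z b))"
    using ev_less_iff[OF assms(4)] by (simp add: not_le)
  also have "\<dots> \<le> sl_index a z b (ev n (bc24 a z b))"
    using assms(1,2) by (rule sl_index_antimono)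
  finally show False
    using ev_less_iff[OF assms(3)] assms(5) by (metis less_irrefl)
qed

section \<open>Semicontinuity of the index in the boundary condition\<close>

lemma sl_pencil_tendsto:
  assumes "(\<alpha> \<longlongrightarrow> a) F" "(\<zeta> \<longlongrightarrow> z) F" "(\<beta> \<longlongrightarrow> b) F"
  shows "((\<lambda>p. sl_pencil (\<alpha> p) (\<zeta> p) (\<beta> p) l i j) \<longlongrightarrow> sl_pencil a z b l i j) F"
  unfolding pencil_def sl_matrix_def sl_diag_def
  by (intro tendsto_diff tendsto_add tendsto_const)
     (auto intro!: tendsto_intros assms)

lemma eventually_sl_index_ge:
  "\<forall>\<^sub>F (a, z, b) in nhds (a0, z0, b0). sl_index a0 z0 b0 t \<le> sl_index a z b t"
proof -
  have "\<forall>\<^sub>F p in nhds (a0, z0, b0). sl_index a0 z0 b0 t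
      \<le> neg_index (Suc N) (sl_pencil (fst p) (fst (snd p)) (snd (snd p)) (of_real t))"
    by (intro neg_index_lower_semicontinuous hermitian_pencil hermitian_sl_matrix sl_pencil_tendsto)
       (auto intro!: tendsto_eq_intros filterlim_ident)
  then show ?thesis by (simp add: case_prod_unfold)
qed

text \<open>Lower semicontinuity of the negated form becomes an upper bound for the index through
  the inertia identity, because there is no kernel at the base point. At the nearby points the
  inequality \<open>neg_index_add_le\<close> suffices.\<close>

lemma eventually_sl_index_le:
  assumes "sl_mult a0 z0 b0 t = 0"
  shows "\<forall>\<^sub>F (a, z, b) in nhds (a0, z0, b0). sl_index a z b t \<le> sl_index a0 z0 b0 t"
proof -
  have "\<forall>\<^sub>F p in nhds (a0, z0, b0). neg_index (Suc N) (- sl_pencil a0 z0 b0 (of_real t))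
      \<le> neg_index (Suc N) (- sl_pencil (fst p) (fst (snd p)) (snd (snd p)) (of_real t))"
    unfolding fun_Compl_def
    by (intro neg_index_lower_semicontinuous hermitian_uminus[unfolded fun_Compl_def]
        hermitian_pencil hermitian_sl_matrix tendsto_minus sl_pencil_tendsto)
       (auto intro!: tendsto_eq_intros filterlim_ident)
  then show ?thesis
  proof eventually_elim
    case (elim p)
    then show ?case
      using inertia[OF hermitian_pencil[OF hermitian_sl_matrix], of "Suc N" N f q a0 z0 b0 "sl_weight w" t]
        neg_index_add_le[OF hermitian_pencil[OF hermitian_sl_matrix], of "Suc N" N f q "fst p" "fst (snd p)" "snd (snd p)" "sl_weight w" t]
        assms by (simp add: case_prod_unfold)
  qed
qed

end

section \<open>Limits of the eigenvalues\<close>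

context sl_problem begin

text \<open>On all of \<open>S\<close> the \<open>n\<close>-th eigenvalue is the first point where the index exceeds \<open>m\<close>.\<close>

definition level :: "(complex^4^2) set set \<Rightarrow> nat \<Rightarrow> nat \<Rightarrow> bool" where
  "level S n m \<longleftrightarrow> S \<subseteq> O24 \<and> (\<forall>a z b. bc24 a z b \<in> S \<longrightarrow> n < count a \<and> n + shift a = m)"

text \<open>The base point may lie outside S and have another shift: only its index is compared with
  the threshold m of S.\<close>

lemma eventually_ev_less:
  assumes S: "level S n m" and "m < sl_index a0 z0 b0 t"
  shows "\<forall>\<^sub>F A in atin_within bc_space (bc24 a0 z0 b0) S. ev n A < t"
proof (rule eventually_atin_within_bc24)
  show "\<forall>\<^sub>F (a, z, b) in nhds (a0, z0, b0). bc24 a z b \<in> S \<longrightarrow> ev n (bc24 a z b) < t"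
    using eventually_sl_index_ge[of a0 z0 b0 t]
  proof eventually_elim
    case (elim p)
    obtain a z b where p: "p = (a, z, b)" using prod_cases3 by blast
    have "ev n (bc24 a z b) < t" if "bc24 a z b \<in> S"
    proof -
      have "n < count a" "n + shift a = m" using S that by (auto simp: level_def)
      then show ?thesis using elim assms(2) unfolding p by (simp add: ev_less_iff)
    qed
    then show ?case by (simp add: p)
  qed
qed (use S in \<open>simp add: level_def\<close>)

lemma eventually_ev_ge:
  assumes S: "level S n m" and "sl_index a0 z0 b0 t \<le> m" and "sl_mult a0 z0 b0 t = 0"
  shows "\<forall>\<^sub>F A in atin_within bc_space (bc24 a0 z0 b0) S. t \<le> ev n A"
proof (rule eventually_atin_within_bc24)
  show "\<forall>\<^sub>F (a, z, b) in nhds (a0, z0, b0). bc24 a z b \<in> S \<longrightarrow> t \<le> ev n (bc24 a z b)"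
    using eventually_sl_index_le[OF assms(3)]
  proof eventually_elim
    case (elim p)
    obtain a z b where p: "p = (a, z, b)" using prod_cases3 by blast
    have "t \<le> ev n (bc24 a z b)" if "bc24 a z b \<in> S"
    proof -
      have "n < count a" "n + shift a = m" using S that by (auto simp: level_def)
      then have "\<not> ev n (bc24 a z b) < t" using elim assms(2) unfolding p by (simp add: ev_less_iff)
      then show ?thesis by simp
    qed
    then show ?case by (simp add: p)
  qed
qed (use S in \<open>simp add: level_def\<close>)

text \<open>\<open>eventually_ev_ge\<close> works only at points that are not eigenvalues;
  finiteness of the spectrum provides them in every interval.\<close>

lemma regular_point_between:
  assumes "s < t"
  obtains r where "s < r" "r < t" "sl_mult a z b r = 0"
proof -
  have "infinite ({s<..<t} - {r. sl_mult a z b r \<noteq> 0})"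
    using infinite_Ioo[OF assms] finite_sl_mult by (rule Diff_infinite_finite[rotated])
  then obtain r where "r \<in> {s<..<t} - {r. sl_mult a z b r \<noteq> 0}"
    by (metis finite.emptyI equals0I)
  then show ?thesis using that by auto
qed

text \<open>Only the thresholds have to agree, so n and n' may differ when S and the base point have
  different shifts. This is how the numbering changes across the layer.\<close>

lemma ev_tendsto:
  assumes S: "level S n m" and n': "n' < count a0" "n' + shift a0 = m"
  shows "(ev n \<longlongrightarrow> ev n' (bc24 a0 z0 b0)) (atin_within bc_space (bc24 a0 z0 b0) S)"
proof (rule order_tendstoI)
  fix t assume "t < ev n' (bc24 a0 z0 b0)"
  then obtain r where r: "t < r" "r < ev n' (bc24 a0 z0 b0)" "sl_mult a0 z0 b0 r = 0"
    by (rule regular_point_between)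
  then have "sl_index a0 z0 b0 r \<le> m"
    using ev_less_iff[OF n'(1), of z0 b0 r] n'(2) by linarith
  then have "\<forall>\<^sub>F A in atin_within bc_space (bc24 a0 z0 b0) S. r \<le> ev n A"
    using S r(3) by (intro eventually_ev_ge)
  then show "\<forall>\<^sub>F A in atin_within bc_space (bc24 a0 z0 b0) S. t < ev n A"
    by eventually_elim (use r(1) in linarith)
next
  fix t assume "ev n' (bc24 a0 z0 b0) < t"
  then have "m < sl_index a0 z0 b0 t"
    using ev_less_iff[OF n'(1)] n'(2) by simp
  with S show "\<forall>\<^sub>F A in atin_within bc_space (bc24 a0 z0 b0) S. ev n A < t"
    by (rule eventually_ev_less)
qed

text \<open>The threshold is an upper bound for the index at the base point at every t, so nearby
  eigenvalues escape beyond any regular point.\<close>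

lemma ev_at_top:
  assumes S: "level S n (count a0 + shift a0)"
  shows "filterlim (ev n) at_top (atin_within bc_space (bc24 a0 z0 b0) S)"
  unfolding filterlim_at_top
proof
  fix t :: real
  obtain r where r: "t < r" "sl_mult a0 z0 b0 r = 0"
    using regular_point_between[of t "t + 1"] by (metis less_add_one)
  have "(\<Sum>s | sl_mult a0 z0 b0 s \<noteq> 0 \<and> s < r. sl_mult a0 z0 b0 s) \<le> count a0"
    unfolding sum_sl_mult[of a0 z0 b0, symmetric] by (intro sum_mono2 finite_sl_mult) auto
  then have "sl_index a0 z0 b0 r \<le> count a0 + shift a0"
    unfolding sl_index_eq by simp
  then have "\<forall>\<^sub>F A in atin_within bc_space (bc24 a0 z0 b0) S. r \<le> ev n A"
    using S r(2) by (intro eventually_ev_ge)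
  then show "\<forall>\<^sub>F A in atin_within bc_space (bc24 a0 z0 b0) S. t \<le> ev n A"
    by eventually_elim (use r(1) in linarith)
qed

text \<open>At the base point the index exceeds the threshold at every t, however negative.\<close>

lemma ev_at_bot:
  assumes S: "level S n m" and "m < shift a0"
  shows "filterlim (ev n) at_bot (atin_within bc_space (bc24 a0 z0 b0) S)"
  unfolding filterlim_at_bot
proof
  fix t :: real
  have "m < sl_index a0 z0 b0 t"
    using assms(2) unfolding sl_index_eq by simp
  with S have "\<forall>\<^sub>F A in atin_within bc_space (bc24 a0 z0 b0) S. ev n A < t"
    by (rule eventually_ev_less)
  then show "\<forall>\<^sub>F A in atin_within bc_space (bc24 a0 z0 b0) S. ev n A \<le> t"
    by eventually_elim simp
qed

section \<open>Limits, continuity and jumps at the layer\<close>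

lemma level_minus: "n < N \<Longrightarrow> level (B24_minus (f 0)) n (n + 1)"
  using layers_subset_O24 by (auto simp: level_def count_def shift_def)

lemma level_plus: "n < N \<Longrightarrow> level (B24_plus (f 0)) n n"
  using layers_subset_O24 by (auto simp: level_def count_def shift_def)

lemma level_minus_Un: "n < N - 1 \<Longrightarrow> level (B24_minus (f 0) \<union> B24 (f 0)) n (n + 1)"
  using layers_subset_O24 by (auto simp: level_def count_def shift_def)

lemma continuous_map_ev:
  assumes "\<And>a z b. bc24 a z b \<in> S \<Longrightarrow>
    (ev n \<longlongrightarrow> ev n (bc24 a z b)) (atin_within bc_space (bc24 a z b) S)" and "S \<subseteq> O24"
  shows "continuous_map (subtopology bc_space S) euclideanreal (ev n)"
  unfolding continuous_map_atin
proof
  fix A assume "A \<in> topspace (subtopology bc_space S)"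
  then have A: "A \<in> S" by simp
  then obtain a z b where "A = bc24 a z b" using assms(2) by (auto simp: O24_def)
  then show "limitin euclideanreal (ev n) (ev n A) (atin (subtopology bc_space S) A)"
    using assms(1) A by (simp add: atin_subtopology_within)
qed

lemma B24_E:
  assumes "A \<in> B24 f0"
  obtains z b where "A = bc24 (- f0) z b"
  using assms by (auto simp: B24_def)

lemma has_exactly_on_B24: "A \<in> B24 (f 0) \<Longrightarrow> has_exactly_eigenvalues N f q w A (N - 1)"
  using has_exactly_eigenvalues_bc24[of "- f 0"] by (auto simp: count_def elim!: B24_E)

lemma has_exactly_off_B24: "A \<in> O24 - B24 (f 0) \<Longrightarrow> has_exactly_eigenvalues N f q w A N"
  using has_exactly_eigenvalues_bc24 by (auto simp: count_def O24_def) metis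

text \<open>Near a point off the exceptional layer only one side of it is met, so the index shift is
  locally constant.\<close>

lemma continuous_off_B24:
  assumes "n < N"
  shows "continuous_map (subtopology bc_space (O24 - B24 (f 0))) euclideanreal (ev n)"
proof (rule continuous_map_ev)
  fix a0 z0 b0 assume "bc24 a0 z0 b0 \<in> O24 - B24 (f 0)"
  then have a0: "a0 \<noteq> - f 0" by simp
  define S where "S = (if a0 < - f 0 then B24_minus (f 0) else B24_plus (f 0))"
  have "level S n (n + shift a0)"
    using level_minus[OF assms] level_plus[OF assms] a0 by (auto simp: S_def shift_def)
  then have lim: "(ev n \<longlongrightarrow> ev n (bc24 a0 z0 b0)) (atin_within bc_space (bc24 a0 z0 b0) S)"
    using assms a0 by (intro ev_tendsto) (auto simp: count_def)
  have "\<forall>\<^sub>F A in atin_within bc_space (bc24 a0 z0 b0) (O24 - B24 (f 0)). A \<in> S"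
  proof (rule eventually_atin_within_bc24)
    define G where "G = {p :: real \<times> complex \<times> real. if a0 < - f 0 then fst p < - f 0 else - f 0 < fst p}"
    have "open G"
      unfolding G_def
      by (cases "a0 < - f 0") (auto intro!: open_Collect_less continuous_intros)
    moreover have "(a0, z0, b0) \<in> G" using a0 by (simp add: G_def)
    ultimately have "\<forall>\<^sub>F p in nhds (a0, z0, b0). p \<in> G" by (rule eventually_nhds_in_open)
    then show "\<forall>\<^sub>F (a, z, b) in nhds (a0, z0, b0). bc24 a z b \<in> O24 - B24 (f 0) \<longrightarrow> bc24 a z b \<in> S"
      by eventually_elim (auto simp: G_def S_def split: if_splits)
  qed auto
  \<comment> \<open>The left filter already concentrates on S, so it is finer than the filter within
    S.\<close>
  then have "atin_within bc_space (bc24 a0 z0 b0) (O24 - B24 (f 0)) \<le> atin_within bc_space (bc24 a0 z0 b0) S"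
    unfolding le_filter_def eventually_atin_within
    by (metis (no_types, lifting) IntE IntI openin_Int)
  with lim show "(ev n \<longlongrightarrow> ev n (bc24 a0 z0 b0)) (atin_within bc_space (bc24 a0 z0 b0) (O24 - B24 (f 0)))"
    by (rule tendsto_mono[rotated])
qed auto

text \<open>The threshold on the plus side is n, and on the layer, where the shift is 1, it belongs
  to n - 1.\<close>

lemma ev_tendsto_plus:
  assumes "A \<in> B24 (f 0)" "n \<in> {1..N - 1}"
  shows "(ev n \<longlongrightarrow> ev (n - 1) A) (atin_within bc_space A (B24_plus (f 0)))"
proof -
  obtain z b where A: "A = bc24 (- f 0) z b" using assms(1) by (rule B24_E)
  show ?thesis
    unfolding A using assms(2) N by (intro ev_tendsto[OF level_plus]) (auto simp: count_def shift_def)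
qed

lemma ev_at_bot_plus:
  assumes "A \<in> B24 (f 0)"
  shows "filterlim (ev 0) at_bot (atin_within bc_space A (B24_plus (f 0)))"
proof -
  obtain z b where A: "A = bc24 (- f 0) z b" using assms(1) by (rule B24_E)
  show ?thesis
    unfolding A using N by (intro ev_at_bot[OF level_plus]) (auto simp: shift_def)
qed

lemma ev_at_top_minus:
  assumes "A \<in> B24 (f 0)"
  shows "filterlim (ev (N - 1)) at_top (atin_within bc_space A (B24_minus (f 0)))"
proof -
  obtain z b where A: "A = bc24 (- f 0) z b" using assms(1) by (rule B24_E)
  \<comment> \<open>Both sides give N: the layer has N - 1 eigenvalues and shift 1, and the last
    eigenvalue on the minus side has index N - 1 and shift 1.\<close>
  have "level (B24_minus (f 0)) (N - 1) (count (- f 0) + shift (- f 0))"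
    using level_minus[of "N - 1"] N by (simp add: count_def shift_def)
  then show ?thesis unfolding A by (rule ev_at_top)
qed

lemma ev_tendsto_minus_Un:
  assumes "a \<le> - f 0" "n \<le> N - 2"
  shows "(ev n \<longlongrightarrow> ev n (bc24 a z b)) (atin_within bc_space (bc24 a z b) (B24_minus (f 0) \<union> B24 (f 0)))"
  using assms N by (intro ev_tendsto[OF level_minus_Un]) (auto simp: count_def shift_def)

text \<open>From the plus side the limit is \<open>ev (n - 1) A\<close>, or minus infinity for
  \<open>n = 0\<close>, which contradicts continuity unless the two values agree. In the excluded
  case of equal consecutive eigenvalues, the limits from both sides of the layer equal
  \<open>ev n A\<close>.\<close>

lemma not_continuous_on_B24:
  assumes A: "A \<in> B24 (f 0)" and "n \<le> N - 1" and neq: "\<not> (n \<in> {1..N - 2} \<and> ev (n - 1) A = ev n A)"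
  shows "\<not> nth_eigenvalue_continuous_at N f q w n A"
proof
  assume cont: "nth_eigenvalue_continuous_at N f q w n A"
  obtain z b where abc: "A = bc24 (- f 0) z b" using A by (rule B24_E)
  let ?F = "atin_within bc_space A (B24_plus (f 0))"
  \<comment> \<open>For \<open>n = N - 1\<close> the eigenvalue is undefined on the layer, so
    continuity already fails by convention.\<close>
  have n: "n < N - 1"
    using cont unfolding nth_eigenvalue_continuous_at_def abc nth_eigenvalue_defined_bc24
    by (simp add: count_def)
  \<comment> \<open>The plus side lies in the domain of definition, so continuity restricts to a
    limit along it.\<close>
  have "B24_plus (f 0) \<subseteq> {A. nth_eigenvalue_defined N f q w n A}"
    using n by (auto simp: B24_plus_def nth_eigenvalue_defined_bc24 count_def)
  then have "?F \<le> atin_within bc_space A {A. nth_eigenvalue_defined N f q w n A}"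
    unfolding atin_within_def by (intro inf_mono) auto
  then have lim: "(ev n \<longlongrightarrow> ev n A) ?F"
    using cont unfolding nth_eigenvalue_continuous_at_def by (metis tendsto_mono)
  have nontriv: "?F \<noteq> bot" unfolding abc by (rule B24_plus_nontrivial)
  show False
  proof (cases "n = 0")
    case True
    then have "\<forall>\<^sub>F B in ?F. ev n B \<le> ev n A - 1"
      using ev_at_bot_plus[OF A] by (simp add: filterlim_at_bot)
    with nontriv lim have "ev n A \<le> ev n A - 1"
      by (intro tendsto_upperbound)
    then show False by simp
  next
    case False
    then have "(ev n \<longlongrightarrow> ev (n - 1) A) ?F"
      using n by (intro ev_tendsto_plus A) auto
    from tendsto_unique[OF nontriv this lim]
    have "ev (n - 1) A = ev n A" .
    then show False using neq n False by auto
  qed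
qed

end

theorem theorem4p2:
  fixes N :: nat and f q w :: "nat \<Rightarrow> real"
  assumes "N \<ge> 2"
    and "\<And>n. n \<le> N \<Longrightarrow> f n \<noteq> 0"
    and "\<And>n. 1 \<le> n \<Longrightarrow> n \<le> N \<Longrightarrow> w n > 0"
  shows
    "(\<forall>A\<in>B24 (f 0). has_exactly_eigenvalues N f q w A (N - 1)) \<and>
     (\<forall>A\<in>O24 - B24 (f 0). has_exactly_eigenvalues N f q w A N) \<and>
     (\<forall>n\<le>N - 1. continuous_map (subtopology bc_space (O24 - B24 (f 0))) euclideanreal
        (nth_eigenvalue N f q w n)) \<and>
     (\<forall>n\<le>N - 1. \<forall>S\<in>{B24_plus (f 0), B24_minus (f 0)}. \<forall>a a' z b.
        bc24 a z b \<in> S \<and> bc24 a' z b \<in> S \<and> a \<le> a' \<longrightarrow>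
        nth_eigenvalue N f q w n (bc24 a z b) \<le> nth_eigenvalue N f q w n (bc24 a' z b)) \<and>
     (\<forall>n\<le>N - 1. \<forall>S\<in>{B24_plus (f 0), B24_minus (f 0)}. \<forall>a z b b'.
        bc24 a z b \<in> S \<and> bc24 a z b' \<in> S \<and> b \<le> b' \<longrightarrow>
        nth_eigenvalue N f q w n (bc24 a z b) \<le> nth_eigenvalue N f q w n (bc24 a z b')) \<and>
     (\<forall>n\<le>N - 1. \<forall>A0\<in>B24 (f 0).
        \<not> (n \<in> {1..N - 2} \<and> nth_eigenvalue N f q w (n - 1) A0 = nth_eigenvalue N f q w n A0) \<longrightarrow>
        \<not> nth_eigenvalue_continuous_at N f q w n A0) \<and>
     (\<forall>A0\<in>B24 (f 0). \<forall>n\<le>N - 2.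
        (nth_eigenvalue N f q w n \<longlongrightarrow> nth_eigenvalue N f q w n A0)
          (atin_within bc_space A0 (B24_minus (f 0) \<union> B24 (f 0)))) \<and>
     (\<forall>A0\<in>B24 (f 0).
        filterlim (nth_eigenvalue N f q w (N - 1)) at_top
          (atin_within bc_space A0 (B24_minus (f 0)))) \<and>
     (\<forall>A0\<in>B24 (f 0).
        filterlim (nth_eigenvalue N f q w 0) at_bot
          (atin_within bc_space A0 (B24_plus (f 0)))) \<and>
     (\<forall>A0\<in>B24 (f 0). \<forall>n\<in>{1..N - 1}.
        (nth_eigenvalue N f q w n \<longlongrightarrow> nth_eigenvalue N f q w (n - 1) A0)
          (atin_within bc_space A0 (B24_plus (f 0)))) \<and>
     (\<forall>n\<le>N - 2. continuous_map (subtopology bc_space (B24_minus (f 0) \<union> B24 (f 0))) euclideanreal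
        (nth_eigenvalue N f q w n))"
proof -
  interpret sl_problem N f q w
    using assms by unfold_locales
  \<comment> \<open>Within one side of the layer both points have the same \<open>shift\<close>, as
    \<open>ev_mono\<close> requires; the two coordinate directions are special cases.\<close>
  have mono: "ev n (bc24 a z b) \<le> ev n (bc24 a' z b')"
    if "n \<le> N - 1" "S \<in> {B24_plus (f 0), B24_minus (f 0)}" "bc24 a z b \<in> S" "bc24 a' z b' \<in> S"
      "a \<le> a'" "b \<le> b'" for n S a a' z b b'
    using that assms(1) by (intro ev_mono) (auto simp: count_def shift_def)
  show ?thesis
  proof (intro conjI)
    show "\<forall>A\<in>B24 (f 0). has_exactly_eigenvalues N f q w A (N - 1)"
      using has_exactly_on_B24 by (rule ballI)
    show "\<forall>A\<in>O24 - B24 (f 0). has_exactly_eigenvalues N f q w A N"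
      using has_exactly_off_B24 by (rule ballI)
    show "\<forall>n\<le>N - 1. continuous_map (subtopology bc_space (O24 - B24 (f 0))) euclideanreal (ev n)"
      using assms(1) by (intro allI impI continuous_off_B24) simp
    show "\<forall>n\<le>N - 1. \<forall>S\<in>{B24_plus (f 0), B24_minus (f 0)}. \<forall>a a' z b.
        bc24 a z b \<in> S \<and> bc24 a' z b \<in> S \<and> a \<le> a' \<longrightarrow> ev n (bc24 a z b) \<le> ev n (bc24 a' z b)"
      using mono[OF _ _ _ _ _ order_refl] by (intro allI impI ballI) (elim conjE)
    show "\<forall>n\<le>N - 1. \<forall>S\<in>{B24_plus (f 0), B24_minus (f 0)}. \<forall>a z b b'.
        bc24 a z b \<in> S \<and> bc24 a z b' \<in> S \<and> b \<le> b' \<longrightarrow> ev n (bc24 a z b) \<le> ev n (bc24 a z b')"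
      using mono[OF _ _ _ _ order_refl] by (intro allI impI ballI) (elim conjE)
    show "\<forall>n\<le>N - 1. \<forall>A0\<in>B24 (f 0). \<not> (n \<in> {1..N - 2} \<and> ev (n - 1) A0 = ev n A0) \<longrightarrow>
        \<not> nth_eigenvalue_continuous_at N f q w n A0"
      by (intro allI impI ballI not_continuous_on_B24)
    show "\<forall>A0\<in>B24 (f 0). \<forall>n\<le>N - 2.
        (ev n \<longlongrightarrow> ev n A0) (atin_within bc_space A0 (B24_minus (f 0) \<union> B24 (f 0)))"
      by (auto elim!: B24_E intro!: ev_tendsto_minus_Un)
    show "\<forall>n\<le>N - 2. continuous_map (subtopology bc_space (B24_minus (f 0) \<union> B24 (f 0))) euclideanreal (ev n)"
      using layers_subset_O24 by (intro allI impI continuous_map_ev ev_tendsto_minus_Un) auto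
  qed (intro ballI ev_at_top_minus ev_at_bot_plus ev_tendsto_plus; assumption)+
qed

end
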